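(* Assume conditions (A) and (B) (standing), the delay condition (C) and the stability condition (S) stated in the context. Let $\varepsilon>0$ satisfy $$\varepsilon<\tfrac12\big[\lambda_1-2\lambda_3-(1-\bar\delta)(\lambda_2+\lambda_4)\big],$$ and let $\gamma^*$ be the unique positive root $\gamma$ of the equation $$[(1-\bar\delta)(\lambda_2+\lambda_4)+\varepsilon]\,e^{\gamma\tau}=\lambda_1-2\lambda_3-\varepsilon-\gamma .$$ Then the solution $\{X_k\}$ generated by the partially truncated Euler–Maruyama method with step size $\Delta$ is almost surely exponentially stable, i.e. $$\limsup_{k\to\infty}\frac{1}{k\Delta}\log|X_k|\le-\frac{\gamma^*}{2}+\varepsilon\quad\text{a.s.}$$
   Context: Notation: $a\vee b=\max(a,b)$, $a\wedge b=\min(a,b)$, $\lfloor a\rfloor$ is the largest integer not exceeding $a$; $|\cdot|$ is the Euclidean norm for vectors and the norm $|A|=\sqrt{\mathrm{trace}(A^TA)}$ for matrices. Setting. On a complete filtered probability space satisfying the usual conditions, $B$ is an $m$-dimensional Brownian motion and $r(t)$ is a right-continuous Markov chain with finite state space $\mathbb S=\{1,\dots,N\}$ and generator $\Gamma=(\gamma_{ij})$, independent of $B$, with $r(0)=i_0\in\mathbb S$. The delay $\delta:[0,\infty)\to[0,\tau]$ is Borel measurable, $\tau>0$, and $\xi:[-\tau,0]\to\mathbb R^n$ is the initial data. Consider $$dx(t)=f(x(t),x(t-\delta(t)),r(t))\,dt+g(x(t),x(t-\delta(t)),r(t))\,dB(t),\ t\ge0,\qquad x(t)=\xi(t),\ t\in[-\tau,0],$$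 where $f:\mathbb R^n\times\mathbb R^n\times\mathbb S\to\mathbb R^n$ and $g:\mathbb R^n\times\mathbb R^n\times\mathbb S\to\mathbb R^{n\times m}$ are measurable and $f=F_1+F$, $g=G_1+G$. Assumptions. (A) There are constants $K_1>0$, $\rho\ge0$ such that for all $x,y,\bar x,\bar y\in\mathbb R^n$, $i\in\mathbb S$: $|F_1(x,y,i)-F_1(\bar x,\bar y,i)|^2\vee|G_1(x,y,i)-G_1(\bar x,\bar y,i)|^2\le K_1(|x-\bar x|^2+|y-\bar y|^2)$ and $|F(x,y,i)-F(\bar x,\bar y,i)|^2\vee|G(x,y,i)-G(\bar x,\bar y,i)|^2\le K_1(1+|x|^\rho+|y|^\rho+|\bar x|^\rho+|\bar y|^\rho)(|x-\bar x|^2+|y-\bar y|^2)$. (B) There are constants $\bar p\ge2$, $K_2>0$ such that $x^TF(x,y,i)+\frac{\bar p-1}{2}|G(x,y,i)|^2\le K_2(1+|x|^2+|y|^2)$ for all $(x,y,i)\in\mathbb R^n\times\mathbb R^n\times\mathbb S$. (C) $\delta(\cdot)$ is bounded and differentiable, with $\frac{d\delta}{dt}\le\bar\delta$ for a constant $\bar\delta\in[0,1)$, and $\tau=\sup_{t\ge0}\delta(t)<\infty$. (S) $\bar\delta\in(0,1)$, and there are $\theta\in[0,\infty]$ and constants $\lambda_1>2\lambda_3\ge2(1-\bar\delta)\lambda_4\ge0$, $\lambda_2\ge0$ such that for all $x,y\in\mathbb R^n$, $i\in\mathbb S$: $2x^TF_1(x,y,i)+(1+\theta)|G_1(x,y,i)|^2\le-\lambda_1|x|^2+\lambda_2(1-\bar\delta)|y|^2$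 and $2x^TF(x,y,i)+(1+\theta^{-1})|G(x,y,i)|^2\le\lambda_3|x|^2+\lambda_4(1-\bar\delta)|y|^2$. Convention: when there is no $G$ term in $g$ one chooses $\theta=0$ and sets $\theta^{-1}|G|^2=0$; when there is no $G_1$ term in $g$ one chooses $\theta=\infty$ and sets $\theta|G_1|^2=0$. Partially truncated Euler–Maruyama method. Fix a strictly increasing continuous $\mu:\mathbb R_+\to\mathbb R_+$ with $\mu(w)\to\infty$ as $w\to\infty$ and $\sup_{|x|\vee|y|\le w}(|F(x,y,i)|\vee|G(x,y,i)|)\le\mu(w)$ for all $w\ge1$, $i\in\mathbb S$; let $\mu^{-1}:[\mu(0),\infty)\to\mathbb R_+$ be its inverse. Fix $\Delta^*\in(0,1]$ and a strictly decreasing $h:(0,\Delta^*]\to(0,\infty)$ with $h(\Delta^* )\ge\mu(1)$, $\lim_{\Delta\to0}h(\Delta)=\infty$ and $\Delta^{1/4}h(\Delta)\le1$ for all $\Delta\in(0,\Delta^*]$. For a given step size $\Delta\in(0,\Delta^*]$ put $\pi_\Delta(x)=(|x|\wedge\mu^{-1}(h(\Delta)))\,x/|x|$ (with $x/|x|=0$ if $x=0$), $F_\Delta(x,y,i)=F(\pi_\Delta(x),\pi_\Delta(y),i)$, $G_\Delta(x,y,i)=G(\pi_\Delta(x),\pi_\Delta(y),i)$, $f_\Delta=F_1+F_\Delta$, $g_\Delta=G_1+G_\Delta$. Let $r_k^\Delta=r(k\Delta)$, $X_k=\xi(k\Delta)$ for integers $k\le0$ with $k\Delta\ge-\tau$,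 and for $k\ge0$, with $\Delta B_k=B((k+1)\Delta)-B(k\Delta)$, $$X_{k+1}=X_k+f_\Delta(X_k,X_{k-\lfloor\delta(k\Delta)/\Delta\rfloor},r_k^\Delta)\Delta+g_\Delta(X_k,X_{k-\lfloor\delta(k\Delta)/\Delta\rfloor},r_k^\Delta)\Delta B_k.$$
   Formalization: The bound is stated for all sufficiently small step sizes (some threshold in (0,Δ*] for the given data) rather than every Δ in (0,Δ*]; for large Δ it fails, e.g. F1=-10x, F=G=G1=0, Δ=Δ*=1 gives X_{k+1}=-9X_k. *)

theory Defs
  imports "HOL-Probability.Probability"
begin

text \<open>
  Library conventions used for the Euclidean objects: vectors are \<open>real ^ 'n\<close>, an \<open>n\<close> by \<open>m\<close>
  matrix is \<open>real ^ 'm ^ 'n\<close>, and \<open>norm\<close> on the latter is the trace norm: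
\<close>

lemma norm_eq_sqrt_trace:
  fixes A :: "real ^ 'm ^ 'n"
  shows "norm A = sqrt (trace (transpose A ** A))"
proof -
  have "trace (transpose A ** A) = (\<Sum>j\<in>UNIV. \<Sum>i\<in>UNIV. A $ i $ j * A $ i $ j)"
    by (simp add: trace_def matrix_matrix_mult_def transpose_def)
  also have "\<dots> = (\<Sum>i\<in>UNIV. \<Sum>j\<in>UNIV. A $ i $ j * A $ i $ j)"
    by (rule sum.swap)
  finally show ?thesis
    by (simp add: norm_eq_sqrt_inner inner_vec_def)
qed


subsection \<open>Filtered probability space, Brownian motion, Markov chain\<close>

definition usual_conditions :: "'a measure \<Rightarrow> (real \<Rightarrow> 'a measure) \<Rightarrow> bool" where
  "usual_conditions M \<F> \<longleftrightarrow>
     complete_measure M \<and>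
     (\<forall>t\<ge>0. subalgebra M (\<F> t)) \<and>
     (\<forall>s\<ge>0. \<forall>t\<ge>s. sets (\<F> s) \<subseteq> sets (\<F> t)) \<and>
     (\<forall>t\<ge>0. sets (\<F> t) = (\<Inter>s\<in>{t<..}. sets (\<F> s))) \<and>
     null_sets M \<subseteq> sets (\<F> 0)"

definition brownian_motion ::
  "'a measure \<Rightarrow> (real \<Rightarrow> 'a measure) \<Rightarrow> (real \<Rightarrow> 'a \<Rightarrow> real ^ 'm) \<Rightarrow> bool" where
  "brownian_motion M \<F> B \<longleftrightarrow>
     (\<forall>t\<ge>0. B t \<in> borel_measurable (\<F> t)) \<and>
     (AE \<omega> in M. B 0 \<omega> = 0) \<and>
     (AE \<omega> in M. continuous_on {0..} (\<lambda>t. B t \<omega>)) \<and>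
     (\<forall>s\<ge>0. \<forall>t>s.
        prob_space.indep_set M (sets (\<F> s))
          {(\<lambda>\<omega>. B t \<omega> - B s \<omega>) -` A \<inter> space M | A. A \<in> sets borel} \<and>
        prob_space.indep_vars M (\<lambda>_. borel) (\<lambda>k \<omega>. (B t \<omega> - B s \<omega>) $ k) UNIV \<and>
        (\<forall>k. distributed M lborel (\<lambda>\<omega>. (B t \<omega> - B s \<omega>) $ k)
               (normal_density 0 (sqrt (t - s)))))"

definition generator_matrix :: "nat \<Rightarrow> (nat \<Rightarrow> nat \<Rightarrow> real) \<Rightarrow> bool" where
  "generator_matrix N \<Gamma> \<longleftrightarrow>
     (\<forall>i\<in>{1..N}. \<forall>j\<in>{1..N}. i \<noteq> j \<longrightarrow> 0 \<le> \<Gamma> i j) \<and>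
     (\<forall>i\<in>{1..N}. \<Gamma> i i = - (\<Sum>j\<in>{1..N} - {i}. \<Gamma> i j))"

text \<open>
  A stochastic transition semigroup on \<open>{1..N}\<close> whose derivative at \<open>0+\<close> is \<open>\<Gamma>\<close>, i.e.
  \<open>P u i j = (if i = j then 1 else 0) + \<Gamma> i j * u + o(u)\<close>.
\<close>

definition transition_semigroup ::
  "nat \<Rightarrow> (nat \<Rightarrow> nat \<Rightarrow> real) \<Rightarrow> (real \<Rightarrow> nat \<Rightarrow> nat \<Rightarrow> real) \<Rightarrow> bool" where
  "transition_semigroup N \<Gamma> P \<longleftrightarrow>
     (\<forall>t\<ge>0. \<forall>i\<in>{1..N}. (\<forall>j\<in>{1..N}. 0 \<le> P t i j) \<and> (\<Sum>j\<in>{1..N}. P t i j) = 1) \<and>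
     (\<forall>s\<ge>0. \<forall>t\<ge>0. \<forall>i\<in>{1..N}. \<forall>j\<in>{1..N}.
        P (s + t) i j = (\<Sum>l\<in>{1..N}. P s i l * P t l j)) \<and>
     (\<forall>i\<in>{1..N}. \<forall>j\<in>{1..N}. P 0 i j = of_bool (i = j)) \<and>
     (\<forall>i\<in>{1..N}. \<forall>j\<in>{1..N}.
        ((\<lambda>u. (P u i j - of_bool (i = j)) / u) \<longlongrightarrow> \<Gamma> i j) (at_right 0))"

text \<open>
  The last clause is the Markov property
  \<open>prob (r t = j | \<F> s) = P (t - s) (r s) j\<close>, integrated over the events of \<open>\<F> s\<close>.
\<close>

definition markov_chain ::
  "'a measure \<Rightarrow> (real \<Rightarrow> 'a measure) \<Rightarrow> nat \<Rightarrow> (nat \<Rightarrow> nat \<Rightarrow> real) \<Rightarrow> (real \<Rightarrow> 'a \<Rightarrow> nat) \<Rightarrow> bool"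
where
  "markov_chain M \<F> N \<Gamma> r \<longleftrightarrow>
     generator_matrix N \<Gamma> \<and>
     (\<forall>t\<ge>0. r t \<in> measurable (\<F> t) (count_space UNIV)) \<and>
     (\<forall>t\<ge>0. \<forall>\<omega>\<in>space M. r t \<omega> \<in> {1..N}) \<and>
     (AE \<omega> in M. \<forall>t\<ge>0. \<forall>\<^sub>F s in at_right t. r s \<omega> = r t \<omega>) \<and>
     (\<exists>P. transition_semigroup N \<Gamma> P \<and>
        (\<forall>s\<ge>0. \<forall>t\<ge>s. \<forall>i\<in>{1..N}. \<forall>j\<in>{1..N}. \<forall>A\<in>sets (\<F> s).
           measure M {\<omega>\<in>A. r s \<omega> = i \<and> r t \<omega> = j} =
           P (t - s) i j * measure M {\<omega>\<in>A. r s \<omega> = i}))"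

definition process_events :: "'a measure \<Rightarrow> 'b measure \<Rightarrow> (real \<Rightarrow> 'a \<Rightarrow> 'b) \<Rightarrow> 'a set set" where
  "process_events M S X = sigma_sets (space M) {X t -` A \<inter> space M | t A. 0 \<le> t \<and> A \<in> sets S}"

definition independent_processes ::
  "'a measure \<Rightarrow> (real \<Rightarrow> 'a \<Rightarrow> nat) \<Rightarrow> (real \<Rightarrow> 'a \<Rightarrow> real ^ 'm) \<Rightarrow> bool" where
  "independent_processes M r B \<longleftrightarrow>
     prob_space.indep_set M (process_events M (count_space UNIV) r) (process_events M borel B)"


subsection \<open>Conditions on the coefficients and on the delay\<close>

text \<open>\<open>x powr 0 = 1\<close> fails in HOL at \<open>x = 0\<close>; here \<open>0\<close> to the power \<open>0\<close> is \<open>1\<close>.\<close>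

definition rpow :: "real \<Rightarrow> real \<Rightarrow> real" where
  "rpow x \<rho> = (if \<rho> = 0 then 1 else x powr \<rho>)"

definition lipschitz_coeff ::
  "nat \<Rightarrow> real \<Rightarrow> (real ^ 'n \<Rightarrow> real ^ 'n \<Rightarrow> nat \<Rightarrow> 'b::real_normed_vector) \<Rightarrow> bool" where
  "lipschitz_coeff N K \<phi> \<longleftrightarrow>
     (\<forall>i\<in>{1..N}. \<forall>x y x' y'.
        (norm (\<phi> x y i - \<phi> x' y' i))\<^sup>2 \<le> K * ((norm (x - x'))\<^sup>2 + (norm (y - y'))\<^sup>2))"

definition poly_lipschitz_coeff ::
  "nat \<Rightarrow> real \<Rightarrow> real \<Rightarrow> (real ^ 'n \<Rightarrow> real ^ 'n \<Rightarrow> nat \<Rightarrow> 'b::real_normed_vector) \<Rightarrow> bool" where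
  "poly_lipschitz_coeff N K \<rho> \<phi> \<longleftrightarrow>
     (\<forall>i\<in>{1..N}. \<forall>x y x' y'.
        (norm (\<phi> x y i - \<phi> x' y' i))\<^sup>2 \<le>
          K * (1 + rpow (norm x) \<rho> + rpow (norm y) \<rho> + rpow (norm x') \<rho> + rpow (norm y') \<rho>)
            * ((norm (x - x'))\<^sup>2 + (norm (y - y'))\<^sup>2))"

definition khasminskii_condition ::
  "nat \<Rightarrow> real \<Rightarrow> real \<Rightarrow> (real ^ 'n \<Rightarrow> real ^ 'n \<Rightarrow> nat \<Rightarrow> real ^ 'n)
     \<Rightarrow> (real ^ 'n \<Rightarrow> real ^ 'n \<Rightarrow> nat \<Rightarrow> real ^ 'm ^ 'n) \<Rightarrow> bool" where
  "khasminskii_condition N p K F G \<longleftrightarrow>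
     (\<forall>i\<in>{1..N}. \<forall>x y.
        x \<bullet> F x y i + (p - 1) / 2 * (norm (G x y i))\<^sup>2 \<le> K * (1 + (norm x)\<^sup>2 + (norm y)\<^sup>2))"

text \<open>
  In \<open>ereal\<close> one has \<open>inverse 0 = \<infinity>\<close>, \<open>inverse \<infinity> = 0\<close> and \<open>\<infinity> * 0 = 0\<close>. Hence \<open>\<theta> = 0\<close> can
  satisfy the second inequality only if \<open>G\<close> vanishes (and then the term with
  \<open>inverse \<theta>\<close> is \<open>0\<close>), and \<open>\<theta> = \<infinity>\<close> can satisfy the first only if \<open>G1\<close> vanishes.
\<close>

definition stability_condition ::
  "nat \<Rightarrow> ereal \<Rightarrow> real \<Rightarrow> real \<Rightarrow> real \<Rightarrow> real \<Rightarrow> real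
     \<Rightarrow> (real ^ 'n \<Rightarrow> real ^ 'n \<Rightarrow> nat \<Rightarrow> real ^ 'n) \<Rightarrow> (real ^ 'n \<Rightarrow> real ^ 'n \<Rightarrow> nat \<Rightarrow> real ^ 'm ^ 'n)
     \<Rightarrow> (real ^ 'n \<Rightarrow> real ^ 'n \<Rightarrow> nat \<Rightarrow> real ^ 'n) \<Rightarrow> (real ^ 'n \<Rightarrow> real ^ 'n \<Rightarrow> nat \<Rightarrow> real ^ 'm ^ 'n)
     \<Rightarrow> bool" where
  "stability_condition N \<theta> \<delta>b l1 l2 l3 l4 F1 G1 F G \<longleftrightarrow>
     0 \<le> \<theta> \<and>
     l1 > 2 * l3 \<and> 2 * l3 \<ge> 2 * (1 - \<delta>b) * l4 \<and> 2 * (1 - \<delta>b) * l4 \<ge> 0 \<and> l2 \<ge> 0 \<and>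
     (\<forall>i\<in>{1..N}. \<forall>x y.
        ereal (2 * (x \<bullet> F1 x y i)) + (1 + \<theta>) * ereal ((norm (G1 x y i))\<^sup>2)
          \<le> ereal (- l1 * (norm x)\<^sup>2 + l2 * (1 - \<delta>b) * (norm y)\<^sup>2) \<and>
        ereal (2 * (x \<bullet> F x y i)) + (1 + inverse \<theta>) * ereal ((norm (G x y i))\<^sup>2)
          \<le> ereal (l3 * (norm x)\<^sup>2 + l4 * (1 - \<delta>b) * (norm y)\<^sup>2))"

definition delay_condition :: "(real \<Rightarrow> real) \<Rightarrow> real \<Rightarrow> real \<Rightarrow> bool" where
  "delay_condition \<delta> \<tau> \<delta>b \<longleftrightarrow>
     bdd_above (\<delta> ` {0..}) \<and> \<tau> = (SUP t\<in>{0..}. \<delta> t) \<and>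
     (\<forall>t\<ge>0. \<exists>D\<le>\<delta>b. (\<delta> has_real_derivative D) (at t within {0..}))"


subsection \<open>The partially truncated Euler--Maruyama scheme\<close>

definition growth_function ::
  "nat \<Rightarrow> (real ^ 'n \<Rightarrow> real ^ 'n \<Rightarrow> nat \<Rightarrow> real ^ 'n)
     \<Rightarrow> (real ^ 'n \<Rightarrow> real ^ 'n \<Rightarrow> nat \<Rightarrow> real ^ 'm ^ 'n) \<Rightarrow> (real \<Rightarrow> real) \<Rightarrow> bool" where
  "growth_function N F G \<mu> \<longleftrightarrow>
     (\<forall>w\<ge>0. 0 \<le> \<mu> w) \<and> strict_mono_on {0..} \<mu> \<and> continuous_on {0..} \<mu> \<and>
     filterlim \<mu> at_top at_top \<and>
     (\<forall>w\<ge>1. \<forall>i\<in>{1..N}. \<forall>x y. max (norm x) (norm y) \<le> w \<longrightarrow>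
        max (norm (F x y i)) (norm (G x y i)) \<le> \<mu> w)"

definition step_function :: "real \<Rightarrow> (real \<Rightarrow> real) \<Rightarrow> (real \<Rightarrow> real) \<Rightarrow> bool" where
  "step_function \<Delta>s \<mu> h \<longleftrightarrow>
     (\<forall>\<Delta>\<in>{0<..\<Delta>s}. 0 < h \<Delta>) \<and> strict_antimono_on {0<..\<Delta>s} h \<and> h \<Delta>s \<ge> \<mu> 1 \<and>
     filterlim h at_top (at_right 0) \<and>
     (\<forall>\<Delta>\<in>{0<..\<Delta>s}. \<Delta> powr (1 / 4) * h \<Delta> \<le> 1)"

definition truncation :: "(real \<Rightarrow> real) \<Rightarrow> (real \<Rightarrow> real) \<Rightarrow> real \<Rightarrow> real ^ 'n \<Rightarrow> real ^ 'n" where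
  "truncation \<mu> h \<Delta> x = min (norm x) (the_inv_into {0..} \<mu> (h \<Delta>)) *\<^sub>R (x /\<^sub>R norm x)"

definition truncated_coeff ::
  "(real \<Rightarrow> real) \<Rightarrow> (real \<Rightarrow> real) \<Rightarrow> real
     \<Rightarrow> (real ^ 'n \<Rightarrow> real ^ 'n \<Rightarrow> nat \<Rightarrow> 'b::real_normed_vector) \<Rightarrow> (real ^ 'n \<Rightarrow> real ^ 'n \<Rightarrow> nat \<Rightarrow> 'b)"
where
  "truncated_coeff \<mu> h \<Delta> \<phi> x y i = \<phi> (truncation \<mu> h \<Delta> x) (truncation \<mu> h \<Delta> y) i"

text \<open>
  The Euler--Maruyama recursion along one sample path \<open>r\<close>, \<open>B\<close> of the chain and of the
  Brownian motion. The argument \<open>k - 1\<close> of the recursive call is the \<open>k\<close> of the usual formula;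
  \<open>nat\<close> does not change the lag, which is nonnegative for a nonnegative delay.
\<close>

function em_scheme ::
  "(real ^ 'n \<Rightarrow> real ^ 'n \<Rightarrow> nat \<Rightarrow> real ^ 'n) \<Rightarrow> (real ^ 'n \<Rightarrow> real ^ 'n \<Rightarrow> nat \<Rightarrow> real ^ 'm ^ 'n)
     \<Rightarrow> (real \<Rightarrow> real) \<Rightarrow> (real \<Rightarrow> real ^ 'n) \<Rightarrow> real \<Rightarrow> (real \<Rightarrow> nat) \<Rightarrow> (real \<Rightarrow> real ^ 'm)
     \<Rightarrow> int \<Rightarrow> real ^ 'n" where
  "em_scheme f g \<delta> \<xi> \<Delta> r B k =
     (if k \<le> 0 then \<xi> (of_int k * \<Delta>)
      else let t = of_int (k - 1) * \<Delta>;
               x = em_scheme f g \<delta> \<xi> \<Delta> r B (k - 1);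
               y = em_scheme f g \<delta> \<xi> \<Delta> r B (k - 1 - int (nat \<lfloor>\<delta> t / \<Delta>\<rfloor>))
           in x + \<Delta> *\<^sub>R f x y (r t) + g x y (r t) *v (B (of_int k * \<Delta>) - B t))"
  by pat_completeness auto
termination
  by (relation "Wellfounded.measure (\<lambda>(f, g, \<delta>, \<xi>, \<Delta>, r, B, k). nat k)") (auto, linarith)

declare em_scheme.simps [simp del]

definition ptem_scheme ::
  "(real ^ 'n \<Rightarrow> real ^ 'n \<Rightarrow> nat \<Rightarrow> real ^ 'n) \<Rightarrow> (real ^ 'n \<Rightarrow> real ^ 'n \<Rightarrow> nat \<Rightarrow> real ^ 'm ^ 'n)
     \<Rightarrow> (real ^ 'n \<Rightarrow> real ^ 'n \<Rightarrow> nat \<Rightarrow> real ^ 'n) \<Rightarrow> (real ^ 'n \<Rightarrow> real ^ 'n \<Rightarrow> nat \<Rightarrow> real ^ 'm ^ 'n)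
     \<Rightarrow> (real \<Rightarrow> real) \<Rightarrow> (real \<Rightarrow> real) \<Rightarrow> (real \<Rightarrow> real) \<Rightarrow> (real \<Rightarrow> real ^ 'n)
     \<Rightarrow> (real \<Rightarrow> 'a \<Rightarrow> nat) \<Rightarrow> (real \<Rightarrow> 'a \<Rightarrow> real ^ 'm) \<Rightarrow> real \<Rightarrow> int \<Rightarrow> 'a \<Rightarrow> real ^ 'n" where
  "ptem_scheme F1 G1 F G \<mu> h \<delta> \<xi> r B \<Delta> k \<omega> =
     em_scheme (\<lambda>x y i. F1 x y i + truncated_coeff \<mu> h \<Delta> F x y i)
       (\<lambda>x y i. G1 x y i + truncated_coeff \<mu> h \<Delta> G x y i)
       \<delta> \<xi> \<Delta> (\<lambda>t. r t \<omega>) (\<lambda>t. B t \<omega>) k"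


subsection \<open>The rate of decay\<close>

definition decay_root ::
  "real \<Rightarrow> real \<Rightarrow> real \<Rightarrow> real \<Rightarrow> real \<Rightarrow> real \<Rightarrow> real \<Rightarrow> real \<Rightarrow> bool" where
  "decay_root \<tau> \<delta>b l1 l2 l3 l4 \<epsilon> \<gamma> \<longleftrightarrow>
     0 < \<gamma> \<and> ((1 - \<delta>b) * (l2 + l4) + \<epsilon>) * exp (\<gamma> * \<tau>) = l1 - 2 * l3 - \<epsilon> - \<gamma>"

text \<open>\<open>ln 0 = 0\<close> in HOL; the value wanted here is \<open>- \<infinity>\<close>.\<close>

definition ext_ln :: "real \<Rightarrow> ereal" where
  "ext_ln x = (if x \<le> 0 then - \<infinity> else ereal (ln x))"

end

theory Submission
  imports Defs
begin

text \<open>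
  The truncated coefficients still satisfy the dissipativity condition, with \<open>\<lambda>\<^sub>3\<close> replaced by
  \<open>2 * \<lambda>\<^sub>3\<close>, and \<open>\<Delta> * \<bar>f\<^sub>\<Delta>\<bar>\<^sup>2\<close> is at most \<open>\<epsilon> * (\<bar>x\<bar>\<^sup>2 + \<bar>y\<bar>\<^sup>2)\<close> for small \<open>\<Delta>\<close>, since the
  coefficients vanish at the origin and \<open>\<Delta> * h(\<Delta>)\<^sup>2 \<le> \<Delta>\<^bsup>1/2\<^esup>\<close>. Hence the second moments \<open>u\<^sub>k\<close> of \<open>X\<^sub>k\<close>
  satisfy \<open>u\<^sub>k\<^sub>+\<^sub>1 \<le> (1 - \<Delta> * a) * u\<^sub>k + \<Delta> * b * u\<^sub>k\<^sub>-\<^sub>d\<close> with a lag \<open>d * \<Delta> \<le> \<tau>\<close>, where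
  \<open>a = \<lambda>\<^sub>1 - 2 * \<lambda>\<^sub>3 - \<epsilon>\<close> and \<open>b = (1 - \<delta>b) * (\<lambda>\<^sub>2 + \<lambda>\<^sub>4) + \<epsilon>\<close>, and a discrete Halanay
  argument gives \<open>u\<^sub>k \<le> C * exp (- \<gamma> * k * \<Delta>)\<close>, where the equation defining \<open>\<gamma>\<close> is exactly what the
  induction needs. The slack \<open>\<epsilon>\<close> in the claim makes
  \<open>\<Sum>k. exp ((\<gamma> - 2 * \<epsilon>) * k * \<Delta>) * \<bar>X\<^sub>k\<bar>\<^sup>2\<close> integrable, hence almost surely finite.
\<close>

subsection \<open>Second moments and independent increments\<close>

text \<open>Every event of \<open>Z\<close> lies in \<open>sets \<G>\<close> and every event of
  \<open>\<psi> (b \<omega>)\<close> is an event of \<open>b\<close>, so the independence assumed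
  for the two large families descends to these variables and the expectation factorises. In this
  form the independence of a Brownian increment from the past enters the moment estimates.\<close>

lemma (in prob_space) has_expectation_mult_indep:
  fixes Z :: "'a \<Rightarrow> real" and b :: "'a \<Rightarrow> 'b::topological_space"
  assumes sub: "subalgebra M \<G>"
    and ind: "indep_set (sets \<G>) {b -` A \<inter> space M | A. A \<in> sets borel}"
    and b: "b \<in> borel_measurable M"
    and Z: "Z \<in> borel_measurable \<G>" "integrable M Z"
    and \<psi>: "\<psi> \<in> borel_measurable borel" "has_bochner_integral M (\<lambda>\<omega>. \<psi> (b \<omega>)) c"
  shows "has_bochner_integral M (\<lambda>\<omega>. Z \<omega> * \<psi> (b \<omega>)) (expectation Z * c)"
proof -
  have spG: "space \<G> = space M" using sub by (simp add: subalgebra_def)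
  have "indep_var borel Z borel (\<lambda>\<omega>. \<psi> (b \<omega>))"
    unfolding indep_var_eq
  \<comment> \<open>\<open>indep_var_eq\<close> speaks of generated sigma-algebras;
    intersection-stable generators suffice, and preimages of Borel sets form such families.\<close>
  proof (intro conjI indep_set_sigma_sets)
    show ZM: "random_variable borel Z"
      using Z(2) by auto
    show "random_variable borel (\<lambda>\<omega>. \<psi> (b \<omega>))"
      using \<psi>(1) b by measurable
    have pre: "\<exists>A'. (\<lambda>\<omega>. \<psi> (b \<omega>)) -` A \<inter> space M = b -` A' \<inter> space M \<and> A' \<in> sets borel"
      if "A \<in> sets borel" for A
      using measurable_sets[OF \<psi>(1) that] by (intro exI[of _ "\<psi> -` A"]) auto
    show "indep_set {Z -` A \<inter> space M |A. A \<in> sets borel}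
            {(\<lambda>\<omega>. \<psi> (b \<omega>)) -` A \<inter> space M |A. A \<in> sets borel}"
      unfolding indep_set_def
    proof (rule indep_sets_mono_sets[OF ind[unfolded indep_set_def]])
      fix i :: bool
      show "(case i of True \<Rightarrow> {Z -` A \<inter> space M |A. A \<in> sets borel}
               | False \<Rightarrow> {(\<lambda>\<omega>. \<psi> (b \<omega>)) -` A \<inter> space M |A. A \<in> sets borel})
           \<subseteq> (case i of True \<Rightarrow> sets \<G> | False \<Rightarrow> {b -` A \<inter> space M |A. A \<in> sets borel})"
        using measurable_sets[OF Z(1)] pre by (auto split: bool.split simp: spG)
    qed
    show "Int_stable {Z -` A \<inter> space M |A. A \<in> sets borel}"
    proof (rule Int_stableI, clarify)
      fix A B :: "real set" assume "A \<in> sets borel" "B \<in> sets borel"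
      then show "\<exists>C. Z -` A \<inter> space M \<inter> (Z -` B \<inter> space M) = Z -` C \<inter> space M \<and> C \<in> sets borel"
        by (intro exI[of _ "A \<inter> B"]) auto
    qed
    show "Int_stable {(\<lambda>\<omega>. \<psi> (b \<omega>)) -` A \<inter> space M |A. A \<in> sets borel}"
    proof (rule Int_stableI, clarify)
      fix A B :: "real set" assume "A \<in> sets borel" "B \<in> sets borel"
      then show "\<exists>C. (\<lambda>\<omega>. \<psi> (b \<omega>)) -` A \<inter> space M \<inter> ((\<lambda>\<omega>. \<psi> (b \<omega>)) -` B \<inter> space M)
                   = (\<lambda>\<omega>. \<psi> (b \<omega>)) -` C \<inter> space M \<and> C \<in> sets borel"
        by (intro exI[of _ "A \<inter> B"]) auto
    qed
  qed
  then show ?thesis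
    using indep_var_integrable[of Z "\<lambda>\<omega>. \<psi> (b \<omega>)"] indep_var_lebesgue_integral[of Z "\<lambda>\<omega>. \<psi> (b \<omega>)"]
      Z(2) \<psi>(2) by (auto simp: has_bochner_integral_iff)
qed

text \<open>A one-step Ito isometry. In components, each mixed term is a
  \<open>\<G>\<close>-measurable factor times one or two coordinates of \<open>b\<close>. Terms with
  one coordinate have mean zero; of those with two only the diagonal \<open>j = l\<close> survives,
  and it adds up to the squared norm of \<open>H\<close>.\<close>

lemma (in prob_space) has_second_moment_affine:
  fixes A :: "'a \<Rightarrow> real ^ 'n" and H :: "'a \<Rightarrow> real ^ 'm ^ 'n" and b :: "'a \<Rightarrow> real ^ 'm"
  assumes sub: "subalgebra M \<G>"
    and A: "A \<in> borel_measurable \<G>" "integrable M (\<lambda>\<omega>. (norm (A \<omega>))\<^sup>2)"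
    and H: "H \<in> borel_measurable \<G>" "integrable M (\<lambda>\<omega>. (norm (H \<omega>))\<^sup>2)"
    and b: "b \<in> borel_measurable M"
    and ind: "indep_set (sets \<G>) {b -` S \<inter> space M | S. S \<in> sets borel}"
    and b1: "\<And>j. has_bochner_integral M (\<lambda>\<omega>. b \<omega> $ j) 0"
    and b2: "\<And>j l. has_bochner_integral M (\<lambda>\<omega>. b \<omega> $ j * b \<omega> $ l) (if j = l then \<sigma> else 0)"
  shows "has_bochner_integral M (\<lambda>\<omega>. (norm (A \<omega> + H \<omega> *v b \<omega>))\<^sup>2)
           (expectation (\<lambda>\<omega>. (norm (A \<omega>))\<^sup>2) + \<sigma> * expectation (\<lambda>\<omega>. (norm (H \<omega>))\<^sup>2))"
proof -
  note [measurable] = A(1) H(1) b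
  have [measurable]: "A \<in> borel_measurable M" "H \<in> borel_measurable M"
    using A(1) H(1) sub measurable_from_subalg by blast+
  have [measurable]: "(\<lambda>v :: real ^ 'k. v $ i) \<in> borel_measurable borel"
      "(\<lambda>v :: real ^ 'm ^ 'k. v $ i) \<in> borel_measurable borel" for i :: "'k::finite"
    by (intro borel_measurable_continuous_onI continuous_intros)+
  \<comment> \<open>Square integrability suffices for the products: they are dominated by the sum of
    the two squared norms.\<close>
  have intAH: "integrable M (\<lambda>\<omega>. A \<omega> $ i * H \<omega> $ i $ j)" for i j
  proof (rule Bochner_Integration.integrable_bound)
    show "integrable M (\<lambda>\<omega>. (norm (A \<omega>))\<^sup>2 + (norm (H \<omega>))\<^sup>2)"
      using A(2) H(2) by simp
    have "\<bar>A \<omega> $ i * H \<omega> $ i $ j\<bar> \<le> (norm (A \<omega>))\<^sup>2 + (norm (H \<omega>))\<^sup>2" for \<omega>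
    proof -
      have "\<bar>A \<omega> $ i\<bar> \<le> norm (A \<omega>)" "\<bar>H \<omega> $ i $ j\<bar> \<le> norm (H \<omega>)"
        using component_le_norm_cart[of "A \<omega>" i] component_le_norm_cart[of "H \<omega> $ i" j]
          Finite_Cartesian_Product.norm_nth_le[of "H \<omega>" i] by linarith+
      then have "\<bar>A \<omega> $ i * H \<omega> $ i $ j\<bar> \<le> norm (A \<omega>) * norm (H \<omega>)"
        by (simp add: abs_mult mult_mono)
      also have "\<dots> \<le> (norm (A \<omega>))\<^sup>2 + (norm (H \<omega>))\<^sup>2"
        using sum_squares_bound[of "norm (A \<omega>)" "norm (H \<omega>)"]
          mult_nonneg_nonneg[OF norm_ge_zero[of "A \<omega>"] norm_ge_zero[of "H \<omega>"]] by linarith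
      finally show ?thesis .
    qed
    then show "AE \<omega> in M. norm (A \<omega> $ i * H \<omega> $ i $ j) \<le> norm ((norm (A \<omega>))\<^sup>2 + (norm (H \<omega>))\<^sup>2)"
      by (auto intro!: AE_I2)
  qed measurable
  have intHH: "integrable M (\<lambda>\<omega>. H \<omega> $ i $ j * H \<omega> $ i $ l)" for i j l
  proof (rule Bochner_Integration.integrable_bound[OF H(2)])
    have "\<bar>H \<omega> $ i $ j * H \<omega> $ i $ l\<bar> \<le> (norm (H \<omega>))\<^sup>2" for \<omega>
    proof -
      have "\<bar>H \<omega> $ i $ j\<bar> \<le> norm (H \<omega>)" "\<bar>H \<omega> $ i $ l\<bar> \<le> norm (H \<omega>)"
        using component_le_norm_cart[of "H \<omega> $ i" l] component_le_norm_cart[of "H \<omega> $ i" j]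
          Finite_Cartesian_Product.norm_nth_le[of "H \<omega>" i] by linarith+
      then show ?thesis
        by (simp add: abs_mult mult_mono power2_eq_square)
    qed
    then show "AE \<omega> in M. norm (H \<omega> $ i $ j * H \<omega> $ i $ l) \<le> norm ((norm (H \<omega>))\<^sup>2)"
      by (auto intro!: AE_I2)
  qed measurable
  have t1: "has_bochner_integral M (\<lambda>\<omega>. (A \<omega> $ i * H \<omega> $ i $ j) * b \<omega> $ j) 0" for i j
    using has_expectation_mult_indep[OF sub ind b _ intAH, of i j "\<lambda>v. v $ j" 0] b1[of j] by simp
  have t2: "has_bochner_integral M (\<lambda>\<omega>. (H \<omega> $ i $ j * H \<omega> $ i $ l) * (b \<omega> $ j * b \<omega> $ l))
      (expectation (\<lambda>\<omega>. H \<omega> $ i $ j * H \<omega> $ i $ l) * (if j = l then \<sigma> else 0))" for i j l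
    using has_expectation_mult_indep[OF sub ind b _ intHH, of i j l "\<lambda>v. v $ j * v $ l"] b2[of j l]
    by simp
  have nrm: "(norm v)\<^sup>2 = (\<Sum>i\<in>UNIV. (norm (v $ i))\<^sup>2)" for v :: "('c::real_normed_vector) ^ 'd"
    by (simp add: norm_vec_def L2_set_def sum_nonneg)
  \<comment> \<open>The grouping keeps the \<open>\<G>\<close>-measurable factors apart from the
    coordinates of \<open>b\<close>, as \<open>t1\<close> and \<open>t2\<close> require.\<close>
  have eq: "(norm (A \<omega> + H \<omega> *v b \<omega>))\<^sup>2 = (norm (A \<omega>))\<^sup>2
      + 2 * (\<Sum>i\<in>UNIV. \<Sum>j\<in>UNIV. (A \<omega> $ i * H \<omega> $ i $ j) * b \<omega> $ j)
      + (\<Sum>i\<in>UNIV. \<Sum>j\<in>UNIV. \<Sum>l\<in>UNIV. (H \<omega> $ i $ j * H \<omega> $ i $ l) * (b \<omega> $ j * b \<omega> $ l))" for \<omega>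
  proof -
    have "(norm (A \<omega> + H \<omega> *v b \<omega>))\<^sup>2 = (\<Sum>i\<in>UNIV. (A \<omega> $ i + (\<Sum>j\<in>UNIV. H \<omega> $ i $ j * b \<omega> $ j))\<^sup>2)"
      by (simp add: nrm matrix_vector_mult_def)
    also have "\<dots> = (\<Sum>i\<in>UNIV. (A \<omega> $ i)\<^sup>2 + 2 * (\<Sum>j\<in>UNIV. (A \<omega> $ i * H \<omega> $ i $ j) * b \<omega> $ j)
        + (\<Sum>j\<in>UNIV. \<Sum>l\<in>UNIV. (H \<omega> $ i $ j * H \<omega> $ i $ l) * (b \<omega> $ j * b \<omega> $ l)))"
    proof (intro sum.cong refl)
      fix i
      have "(u + v)\<^sup>2 = u\<^sup>2 + 2 * (u * v) + v * v" for u v :: real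
        by (simp add: power2_eq_square algebra_simps)
      then show "(A \<omega> $ i + (\<Sum>j\<in>UNIV. H \<omega> $ i $ j * b \<omega> $ j))\<^sup>2
          = (A \<omega> $ i)\<^sup>2 + 2 * (\<Sum>j\<in>UNIV. (A \<omega> $ i * H \<omega> $ i $ j) * b \<omega> $ j)
            + (\<Sum>j\<in>UNIV. \<Sum>l\<in>UNIV. (H \<omega> $ i $ j * H \<omega> $ i $ l) * (b \<omega> $ j * b \<omega> $ l))"
        by (simp add: sum_product sum_distrib_left ac_simps)
    qed
    finally show ?thesis
      by (simp add: sum.distrib sum_distrib_left nrm)
  qed
  have "has_bochner_integral M (\<lambda>\<omega>. (norm (A \<omega> + H \<omega> *v b \<omega>))\<^sup>2) (expectation (\<lambda>\<omega>. (norm (A \<omega>))\<^sup>2)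
      + 2 * (\<Sum>i\<in>(UNIV::'n set). \<Sum>j\<in>(UNIV::'m set). 0)
      + (\<Sum>i\<in>UNIV. \<Sum>j\<in>UNIV. \<Sum>l\<in>UNIV.
          expectation (\<lambda>\<omega>. H \<omega> $ i $ j * H \<omega> $ i $ l) * (if j = l then \<sigma> else 0)))"
    unfolding eq
    by (intro has_bochner_integral_add has_bochner_integral_mult_right has_bochner_integral_sum t1 t2
        has_bochner_integral_integrable A(2))
  moreover have "(\<Sum>i\<in>UNIV. \<Sum>j\<in>UNIV. \<Sum>l\<in>UNIV.
          expectation (\<lambda>\<omega>. H \<omega> $ i $ j * H \<omega> $ i $ l) * (if j = l then \<sigma> else 0))
      = \<sigma> * expectation (\<lambda>\<omega>. (norm (H \<omega>))\<^sup>2)"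
  proof -
    have "expectation (\<lambda>\<omega>. (norm (H \<omega>))\<^sup>2)
        = (\<Sum>i\<in>UNIV. \<Sum>j\<in>UNIV. expectation (\<lambda>\<omega>. H \<omega> $ i $ j * H \<omega> $ i $ j))"
      unfolding nrm[of "H _"] nrm[of "H _ $ _"] using intHH by (simp add: power2_eq_square)
    then show ?thesis
      by (simp add: sum_distrib_left mult_delta_right mult.commute[of _ \<sigma>])
  qed
  ultimately show ?thesis by simp
qed

text \<open>Mean and variance of a coordinate are read off its normal density; for two different
  coordinates independence turns the expectation into a product of zeros.\<close>

lemma (in prob_space) brownian_increment_moments:
  fixes B :: "real \<Rightarrow> 'a \<Rightarrow> real ^ 'm"
  assumes "brownian_motion M \<F> B" and st: "0 \<le> s" "s < t"
  shows "has_bochner_integral M (\<lambda>\<omega>. (B t \<omega> - B s \<omega>) $ j) 0" (is ?first)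
    and "has_bochner_integral M (\<lambda>\<omega>. (B t \<omega> - B s \<omega>) $ j * (B t \<omega> - B s \<omega>) $ l)
           (if j = l then t - s else 0)" (is ?second)
proof -
  define b where "b = (\<lambda>k \<omega>. (B t \<omega> - B s \<omega>) $ k)"
  have iv: "indep_vars (\<lambda>_. borel) b UNIV"
    and D: "distributed M lborel (b k) (normal_density 0 (sqrt (t - s)))" for k
    using assms unfolding brownian_motion_def b_def by blast+
  have pos: "0 < sqrt (t - s)" using st by simp
  have i1: "integrable M (b k)" for k
    using distributed_integrable_var[OF D] integrable_normal_moment_nz_1[OF pos] by simp
  have e1: "expectation (b k) = 0" for k
    by (rule normal_distributed_expectation[OF pos D])
  have i2: "integrable M (\<lambda>\<omega>. b k \<omega> * b k \<omega>)" for k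
    using distributed_integrable[OF D, of "\<lambda>x. x * x"] integrable_normal_moment[OF pos, of 0 2]
    by (simp add: power2_eq_square)
  have e2: "expectation (\<lambda>\<omega>. b k \<omega> * b k \<omega>) = t - s" for k
    using normal_distributed_variance[OF pos D] st by (simp add: e1 power2_eq_square)
  have "has_bochner_integral M (\<lambda>\<omega>. b j \<omega> * b l \<omega>) 0" if "j \<noteq> l"
  proof -
    have "indep_vars (\<lambda>_. borel) b {j, l}"
      by (rule indep_vars_subset[OF iv]) simp
    from indep_vars_lebesgue_integral[OF _ this] indep_vars_integrable[OF _ this] that
    show ?thesis by (simp add: has_bochner_integral_iff i1 e1)
  qed
  then show ?first ?second
    using i1 e1 i2 e2 unfolding b_def by (auto simp: has_bochner_integral_iff)
qed

subsection \<open>Coefficients and their truncation\<close>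

lemma rpow_nonneg [simp]: "0 \<le> rpow x \<rho>"
  by (simp add: rpow_def)

lemma rpow_le_1: "0 \<le> \<rho> \<Longrightarrow> 0 \<le> x \<Longrightarrow> x \<le> 1 \<Longrightarrow> rpow x \<rho> \<le> 1"
  by (auto simp: rpow_def intro: powr_le1)

lemma tendsto_rpow:
  assumes "0 \<le> \<rho>" "(f \<longlongrightarrow> a) F" "\<And>x. 0 \<le> f x"
  shows "((\<lambda>x. rpow (f x) \<rho>) \<longlongrightarrow> rpow a \<rho>) F"
  using assms by (cases "\<rho> = 0") (auto simp: rpow_def intro!: tendsto_powr2)

text \<open>With exponent 0 the weight is the constant 5, which only enlarges the bound; thus
  \<open>F1\<close> and \<open>G1\<close> fall under the lemmas made for \<open>F\<close> and
  \<open>G\<close>.\<close>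

lemma lipschitz_imp_poly_lipschitz:
  assumes "0 \<le> K" "lipschitz_coeff N K \<phi>"
  shows "poly_lipschitz_coeff N K 0 \<phi>"
  unfolding poly_lipschitz_coeff_def
proof (intro ballI allI)
  fix i x y x' y' assume "i \<in> {1..N}"
  then have "(norm (\<phi> x y i - \<phi> x' y' i))\<^sup>2 \<le> K * ((norm (x - x'))\<^sup>2 + (norm (y - y'))\<^sup>2)"
    using assms(2) by (auto simp: lipschitz_coeff_def)
  also have "\<dots> \<le> (K * 5) * ((norm (x - x'))\<^sup>2 + (norm (y - y'))\<^sup>2)"
    using assms(1) by (intro mult_right_mono) auto
  finally show "(norm (\<phi> x y i - \<phi> x' y' i))\<^sup>2 \<le>
      K * (1 + rpow (norm x) 0 + rpow (norm y) 0 + rpow (norm x') 0 + rpow (norm y') 0)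
        * ((norm (x - x'))\<^sup>2 + (norm (y - y'))\<^sup>2)"
    by (simp add: rpow_def)
qed

text \<open>As the arguments approach \<open>c\<close> the weight converges and the squared
  increments tend to 0, so the square root of the Lipschitz bound is a null majorant.\<close>

lemma poly_lipschitz_continuous:
  fixes \<phi> :: "real ^ 'n \<Rightarrow> real ^ 'n \<Rightarrow> nat \<Rightarrow> 'b::real_normed_vector"
  assumes lip: "poly_lipschitz_coeff N K \<rho> \<phi>" and "0 \<le> \<rho>" "i \<in> {1..N}"
  shows "continuous_on UNIV (\<lambda>(x, y). \<phi> x y i)"
proof -
  have "((\<lambda>z. \<phi> (fst z) (snd z) i) \<longlongrightarrow> \<phi> (fst c) (snd c) i) (at c)" for c
  proof -
    define u where "u = (\<lambda>z. K * (1 + rpow (norm (fst z)) \<rho> + rpow (norm (snd z)) \<rho>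
        + rpow (norm (fst c)) \<rho> + rpow (norm (snd c)) \<rho>)
        * ((norm (fst z - fst c))\<^sup>2 + (norm (snd z - snd c))\<^sup>2))"
    have "(u \<longlongrightarrow> K * (1 + rpow (norm (fst c)) \<rho> + rpow (norm (snd c)) \<rho>
        + rpow (norm (fst c)) \<rho> + rpow (norm (snd c)) \<rho>)
        * ((norm (fst c - fst c))\<^sup>2 + (norm (snd c - snd c))\<^sup>2)) (at c)"
      unfolding u_def using assms(2) by (intro tendsto_intros tendsto_rpow) auto
    then have "((\<lambda>z. sqrt (u z)) \<longlongrightarrow> sqrt 0) (at c)"
      by (intro tendsto_real_sqrt) simp
    moreover have "norm (\<phi> (fst z) (snd z) i - \<phi> (fst c) (snd c) i) \<le> sqrt (u z)" for z
      using lip assms(3) unfolding poly_lipschitz_coeff_def u_def by (intro real_le_rsqrt) blast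
    ultimately show ?thesis
      using Lim_null_comparison[of "\<lambda>z. \<phi> (fst z) (snd z) i - \<phi> (fst c) (snd c) i" "\<lambda>z. sqrt (u z)" "at c"]
      by (simp add: LIM_zero_iff)
  qed
  then show ?thesis
    by (simp add: continuous_on_def case_prod_beta)
qed

lemma poly_lipschitz_measurable:
  fixes \<phi> :: "real ^ 'n \<Rightarrow> real ^ 'n \<Rightarrow> nat \<Rightarrow> 'b::real_normed_vector"
  assumes "poly_lipschitz_coeff N K \<rho> \<phi>" "0 \<le> \<rho>" "i \<in> {1..N}"
  shows "(\<lambda>(x, y). \<phi> x y i) \<in> borel_measurable (borel \<Otimes>\<^sub>M borel)"
  unfolding borel_prod
  by (rule borel_measurable_continuous_onI[OF poly_lipschitz_continuous[OF assms]])

text \<open>Test the bound along the ray \<open>s *\<^sub>R v\<close> with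
  \<open>v = \<phi> 0\<close>. After division by \<open>s\<close> the right side is of order
  \<open>s\<close>, so letting \<open>s\<close> decrease to 0 leaves
  \<open>v \<bullet> v \<le> 0\<close>. The sign of \<open>c\<close> is arbitrary.\<close>

lemma zero_at_origin_if_inner_le:
  fixes \<phi> :: "'a::real_inner \<Rightarrow> 'a"
  assumes cont: "isCont \<phi> 0" and le: "\<And>x. x \<bullet> \<phi> x \<le> c * (norm x)\<^sup>2"
  shows "\<phi> 0 = 0"
proof -
  define v where "v = \<phi> 0"
  have "\<forall>\<^sub>F s in at_right 0. v \<bullet> \<phi> (s *\<^sub>R v) \<le> c * s * (norm v)\<^sup>2"
    unfolding eventually_at_right_field
  proof (intro exI[of _ 1] conjI allI impI)
    fix s :: real assume "0 < s"
    moreover have "s * (v \<bullet> \<phi> (s *\<^sub>R v)) \<le> s * (c * s * (norm v)\<^sup>2)"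
      using le[of "s *\<^sub>R v"] by (simp add: power2_eq_square ac_simps)
    ultimately show "v \<bullet> \<phi> (s *\<^sub>R v) \<le> c * s * (norm v)\<^sup>2" by simp
  qed simp
  moreover have "((\<lambda>s. v \<bullet> \<phi> (s *\<^sub>R v)) \<longlongrightarrow> v \<bullet> \<phi> 0) (at_right 0)"
    by (intro tendsto_inner tendsto_const isCont_tendsto_compose[OF cont])
       (rule tendsto_eq_intros refl | simp)+
  moreover have "((\<lambda>s. c * s * (norm v)\<^sup>2) \<longlongrightarrow> c * 0 * (norm v)\<^sup>2) (at_right 0)"
    by (intro tendsto_intros)
  ultimately have "v \<bullet> \<phi> 0 \<le> c * 0 * (norm v)\<^sup>2"
    by (intro tendsto_le[OF trivial_limit_at_right_real])
  then have "v \<bullet> v \<le> 0" by (simp add: v_def)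
  then show ?thesis by (metis inner_gt_zero_iff not_le v_def)
qed

text \<open>Young's inequality, from the square of \<open>t *\<^sub>R u - v\<close> divided by
  \<open>t\<close>; here \<open>t\<close> stands for a finite positive
  \<open>\<theta>\<close>.\<close>

lemma norm_add_sq_le_weighted:
  fixes u v :: "'a::real_inner"
  assumes "0 < t"
  shows "(norm (u + v))\<^sup>2 \<le> (1 + t) * (norm u)\<^sup>2 + (1 + inverse t) * (norm v)\<^sup>2"
proof -
  have "0 \<le> inverse t * (norm (t *\<^sub>R u - v))\<^sup>2"
    using assms by simp
  also have "(norm (t *\<^sub>R u - v))\<^sup>2 = t\<^sup>2 * (norm u)\<^sup>2 - 2 * t * (u \<bullet> v) + (norm v)\<^sup>2"
    unfolding power2_norm_eq_inner by (simp add: inner_diff inner_commute power2_eq_square algebra_simps)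
  also have "inverse t * \<dots> = t * (norm u)\<^sup>2 - 2 * (u \<bullet> v) + inverse t * (norm v)\<^sup>2"
    using assms by (simp add: field_simps power2_eq_square)
  finally show ?thesis
    unfolding power2_norm_eq_inner by (simp add: inner_add inner_commute algebra_simps)
qed

text \<open>Makes the conventions for \<open>\<theta> = 0\<close> and \<open>\<theta> = \<infinity>\<close> disappear: in these cases \<open>G\<close> or \<open>G1\<close>
  vanishes and the weights \<open>q1 = q2 = 1\<close> serve.\<close>

lemma stability_condition_weights:
  fixes F1 F :: "real ^ 'n \<Rightarrow> real ^ 'n \<Rightarrow> nat \<Rightarrow> real ^ 'n"
    and G1 G :: "real ^ 'n \<Rightarrow> real ^ 'n \<Rightarrow> nat \<Rightarrow> real ^ 'm ^ 'n"
  assumes "stability_condition N \<theta> \<delta>b l1 l2 l3 l4 F1 G1 F G"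
  obtains q1 q2 :: real where "0 < q1" "0 < q2"
    "\<And>i x y. i \<in> {1..N} \<Longrightarrow> 2 * (x \<bullet> F1 x y i) + q1 * (norm (G1 x y i))\<^sup>2
       \<le> - l1 * (norm x)\<^sup>2 + l2 * (1 - \<delta>b) * (norm y)\<^sup>2"
    "\<And>i x y. i \<in> {1..N} \<Longrightarrow> 2 * (x \<bullet> F x y i) + q2 * (norm (G x y i))\<^sup>2
       \<le> l3 * (norm x)\<^sup>2 + l4 * (1 - \<delta>b) * (norm y)\<^sup>2"
    "\<And>i x y x' y'. i \<in> {1..N} \<Longrightarrow>
       (norm (G1 x y i + G x' y' i))\<^sup>2 \<le> q1 * (norm (G1 x y i))\<^sup>2 + q2 * (norm (G x' y' i))\<^sup>2"
proof -
  have th: "0 \<le> \<theta>"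
    and c1: "\<And>i x y. i \<in> {1..N} \<Longrightarrow>
      ereal (2 * (x \<bullet> F1 x y i)) + (1 + \<theta>) * ereal ((norm (G1 x y i))\<^sup>2)
        \<le> ereal (- l1 * (norm x)\<^sup>2 + l2 * (1 - \<delta>b) * (norm y)\<^sup>2)"
    and c2: "\<And>i x y. i \<in> {1..N} \<Longrightarrow>
      ereal (2 * (x \<bullet> F x y i)) + (1 + inverse \<theta>) * ereal ((norm (G x y i))\<^sup>2)
        \<le> ereal (l3 * (norm x)\<^sup>2 + l4 * (1 - \<delta>b) * (norm y)\<^sup>2)"
    using assms unfolding stability_condition_def by blast+
  consider "\<theta> = 0" | "\<theta> = \<infinity>" | t where "\<theta> = ereal t" "0 < t"
    using th by (cases \<theta>) (auto simp: zero_ereal_def less_le)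
  then show ?thesis
  proof cases
    case 1
    have "G x y i = 0" if "i \<in> {1..N}" for i x y
      using c2[OF that, of x y] 1 by (cases "G x y i = 0") auto
    then show ?thesis
      using that[of 1 1] c1 c2 1 by (auto simp: one_ereal_def)
  next
    case 2
    have "G1 x y i = 0" if "i \<in> {1..N}" for i x y
      using c1[OF that, of x y] 2 by (cases "G1 x y i = 0") auto
    then show ?thesis
      using that[of 1 1] c1 c2 2 by (auto simp: one_ereal_def)
  next
    case 3
    have eqs: "1 + \<theta> = ereal (1 + t)" "1 + inverse \<theta> = ereal (1 + inverse t)"
      using 3 by (auto simp: one_ereal_def)
    show ?thesis
    proof (rule that)
      show "0 < 1 + t" "0 < 1 + inverse t" using 3 by (simp_all add: add_pos_pos)
    next
      fix i x y assume "i \<in> {1..N}"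
      then show "2 * (x \<bullet> F1 x y i) + (1 + t) * (norm (G1 x y i))\<^sup>2
          \<le> - l1 * (norm x)\<^sup>2 + l2 * (1 - \<delta>b) * (norm y)\<^sup>2"
        using c1[of i x y] unfolding eqs times_ereal.simps plus_ereal.simps ereal_less_eq by blast
    next
      fix i x y assume "i \<in> {1..N}"
      then show "2 * (x \<bullet> F x y i) + (1 + inverse t) * (norm (G x y i))\<^sup>2
          \<le> l3 * (norm x)\<^sup>2 + l4 * (1 - \<delta>b) * (norm y)\<^sup>2"
        using c2[of i x y] unfolding eqs times_ereal.simps plus_ereal.simps ereal_less_eq by blast
    qed (rule norm_add_sq_le_weighted[OF \<open>0 < t\<close>])
  qed
qed

section \<open>The truncation map and the growth of the truncated coefficients\<close>

lemma norm_truncation_eq: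
  assumes "0 \<le> the_inv_into {0..} \<mu> (h \<Delta>)"
  shows "norm (truncation \<mu> h \<Delta> x) = min (norm x) (the_inv_into {0..} \<mu> (h \<Delta>))"
  using assms by (cases "x = 0") (auto simp: truncation_def)

lemma truncation_eq_self:
  "norm x \<le> the_inv_into {0..} \<mu> (h \<Delta>) \<Longrightarrow> truncation \<mu> h \<Delta> x = x"
  by (cases "x = 0") (auto simp: truncation_def)

text \<open>Outside the truncation radius \<open>R\<close> the drift is evaluated at a point of norm \<open>R\<close> in direction
  \<open>x\<close>, where both terms of the bound are at most \<open>l * R\<^sup>2\<close>; this costs the factor \<open>2\<close> in front of
  \<open>l\<close>.\<close>

lemma truncated_drift_le:
  fixes F :: "real ^ 'n \<Rightarrow> real ^ 'n \<Rightarrow> real ^ 'n" and G :: "real ^ 'n \<Rightarrow> real ^ 'n \<Rightarrow> 'b::real_normed_vector"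
  assumes drift: "\<And>x y. 2 * (x \<bullet> F x y) + q * (norm (G x y))\<^sup>2 \<le> l * (norm x)\<^sup>2 + c * (norm y)\<^sup>2"
    and nonneg: "0 \<le> q" "0 \<le> c" "c \<le> l"
    and R: "0 < the_inv_into {0..} \<mu> (h \<Delta>)"
  defines "T \<equiv> truncation \<mu> h \<Delta>"
  shows "2 * (x \<bullet> F (T x) (T y)) + q * (norm (G (T x) (T y)))\<^sup>2 \<le> 2 * l * (norm x)\<^sup>2 + c * (norm y)\<^sup>2"
proof -
  define R where "R = the_inv_into {0..} \<mu> (h \<Delta>)"
  have R0: "0 < R" using R by (simp add: R_def)
  have nT: "norm (T z) = min (norm z) R" for z
    using norm_truncation_eq[of \<mu> h \<Delta> z] R by (simp add: T_def R_def)
  show ?thesis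
  proof (cases "norm x \<le> R")
    case True
    then have "T x = x" by (simp add: T_def R_def truncation_eq_self)
    then have "2 * (x \<bullet> F (T x) (T y)) + q * (norm (G (T x) (T y)))\<^sup>2 \<le> l * (norm x)\<^sup>2 + c * (norm (T y))\<^sup>2"
      using drift[of x "T y"] by simp
    also have "\<dots> \<le> 2 * l * (norm x)\<^sup>2 + c * (norm y)\<^sup>2"
      using nonneg R0 nT[of y] by (intro add_mono mult_mono power_mono) auto
    finally show ?thesis .
  next
    case False
    define s where "s = norm x / R"
    have s1: "1 \<le> s" using False R0 by (simp add: s_def)
    have "x \<noteq> 0" using False R0 by auto
    then have xs: "x = s *\<^sub>R T x"
      using False R0 by (simp add: s_def T_def truncation_def R_def[symmetric])
    have nTx: "norm (T x) = R" using False nT[of x] by simp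
    let ?g = "q * (norm (G (T x) (T y)))\<^sup>2"
    have g0: "0 \<le> ?g" using nonneg by simp
    have "x \<bullet> v = s * (T x \<bullet> v)" for v
      using arg_cong[OF xs, of "\<lambda>z. z \<bullet> v"] by simp
    then have "2 * (x \<bullet> F (T x) (T y)) = s * (2 * (T x \<bullet> F (T x) (T y)))"
      by simp
    also have "\<dots> \<le> s * (l * R\<^sup>2 + c * (norm (T y))\<^sup>2 - ?g)"
    proof (rule mult_left_mono)
      show "2 * (T x \<bullet> F (T x) (T y)) \<le> l * R\<^sup>2 + c * (norm (T y))\<^sup>2 - ?g"
        using drift[of "T x" "T y"] nTx by simp
    qed (use s1 in simp)
    also have "\<dots> \<le> s * (l * R\<^sup>2 + l * R\<^sup>2 - ?g)"
      using s1 nonneg nT[of y] R0 by (intro mult_left_mono diff_right_mono add_left_mono mult_mono power_mono) auto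
    also have "\<dots> = s * (2 * l * R\<^sup>2) - s * ?g"
      by (simp add: algebra_simps)
    \<comment> \<open>The factor \<open>s \<ge> 1\<close> is harmless in both terms:
      \<open>s * R\<^sup>2 = norm x * R\<close> stays below \<open>(norm x)\<^sup>2\<close>, and the
      subtracted \<open>s * ?g\<close> is at least \<open>?g\<close>.\<close>
    also have "\<dots> \<le> 2 * l * (norm x)\<^sup>2 - ?g"
    proof (intro diff_mono)
      have "s * (2 * l * R\<^sup>2) = 2 * l * (norm x * R)"
        using R0 by (simp add: s_def power2_eq_square)
      also have "\<dots> \<le> 2 * l * (norm x)\<^sup>2"
        using mult_left_mono[of R "norm x" "norm x"] False nonneg
        by (intro mult_left_mono) (auto simp: power2_eq_square)
      finally show "s * (2 * l * R\<^sup>2) \<le> 2 * l * (norm x)\<^sup>2" .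
      show "?g \<le> s * ?g" using s1 g0 mult_right_mono[of 1 s ?g] by simp
    qed
    finally show ?thesis
      using mult_nonneg_nonneg[OF nonneg(2) zero_le_power2[of "norm y"]] by linarith
  qed
qed

text \<open>Since \<open>h\<close> decreases and \<open>h \<Delta>s \<ge> \<mu> 1\<close>, the
  intermediate value theorem gives a point of \<open>{1..}\<close> where \<open>\<mu>\<close> equals
  \<open>h \<Delta>\<close>, and injectivity makes \<open>the_inv_into\<close> return it. A radius
  of at least 1 leaves the unit ball untouched by the truncation.\<close>

lemma truncation_radius:
  assumes mu: "growth_function N F G \<mu>" and step: "step_function \<Delta>s \<mu> h" and \<Delta>: "\<Delta> \<in> {0<..\<Delta>s}"
  shows "1 \<le> the_inv_into {0..} \<mu> (h \<Delta>)" and "\<mu> (the_inv_into {0..} \<mu> (h \<Delta>)) = h \<Delta>"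
proof -
  have mono: "strict_mono_on {0..} \<mu>" and cont: "continuous_on {0..} \<mu>"
    and lim: "filterlim \<mu> at_top at_top"
    using mu unfolding growth_function_def by blast+
  have anti: "strict_antimono_on {0<..\<Delta>s} h" and hs: "\<mu> 1 \<le> h \<Delta>s"
    using step unfolding step_function_def by blast+
  have "h \<Delta>s \<le> h \<Delta>"
    using monotone_onD[OF anti \<Delta>, of \<Delta>s] \<Delta> by (cases "\<Delta> = \<Delta>s") auto
  then have low: "\<mu> 1 \<le> h \<Delta>" using hs by simp
  from lim have "\<forall>\<^sub>F w in at_top. h \<Delta> \<le> \<mu> w"
    by (simp add: filterlim_at_top)
  then obtain w where w: "\<And>v. w \<le> v \<Longrightarrow> h \<Delta> \<le> \<mu> v"
    by (auto simp: eventually_at_top_linorder)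
  have "\<exists>R\<ge>1. R \<le> max w 1 \<and> \<mu> R = h \<Delta>"
    by (rule IVT'[of \<mu>]) (use low w[of "max w 1"] in \<open>auto intro: continuous_on_subset[OF cont]\<close>)
  then obtain R where R: "1 \<le> R" "\<mu> R = h \<Delta>" by blast
  have "the_inv_into {0..} \<mu> (\<mu> R) = R"
    using R strict_mono_on_imp_inj_on[OF mono] by (intro the_inv_into_f_f) auto
  then show "1 \<le> the_inv_into {0..} \<mu> (h \<Delta>)" "\<mu> (the_inv_into {0..} \<mu> (h \<Delta>)) = h \<Delta>"
    using R by simp_all
qed

text \<open>At \<open>y = 0\<close> the nonnegative \<open>G\<close> term may be dropped, which
  leaves a one-sided bound for \<open>F\<close>; at \<open>x = y = 0\<close> the right side is 0 and
  forces \<open>G\<close> to vanish. A bound of the coefficients by a multiple of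
  \<open>(norm x)\<^sup>2 + (norm y)\<^sup>2\<close> depends on this.\<close>

lemma vanish_at_origin_if_drift_le:
  fixes F :: "real ^ 'n \<Rightarrow> real ^ 'n \<Rightarrow> nat \<Rightarrow> real ^ 'n"
  assumes lip: "poly_lipschitz_coeff N K \<rho> F" "0 \<le> \<rho>" "i \<in> {1..N}" and q: "0 < q"
    and drift: "\<And>x y. 2 * (x \<bullet> F x y i) + q * (norm (G x y i))\<^sup>2 \<le> c * (norm x)\<^sup>2 + d * (norm y)\<^sup>2"
  shows "F 0 0 i = 0" and "G 0 0 i = (0 :: 'b::real_normed_vector)"
proof -
  have "(\<lambda>(x, y). F x y i) \<circ> (\<lambda>x. (x, 0)) = (\<lambda>x. F x 0 i)" by auto
  moreover have "continuous_on UNIV ((\<lambda>(x, y). F x y i) \<circ> (\<lambda>x. (x, 0)))"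
    by (intro continuous_on_compose continuous_intros
        continuous_on_subset[OF poly_lipschitz_continuous[OF lip]]) auto
  ultimately have "isCont (\<lambda>x. F x 0 i) 0"
    by (simp add: continuous_on_eq_continuous_at)
  moreover have "x \<bullet> F x 0 i \<le> (c / 2) * (norm x)\<^sup>2" for x
  proof -
    have "0 \<le> q * (norm (G x 0 i))\<^sup>2" using q by simp
    then show ?thesis using drift[of x 0] by simp
  qed
  ultimately show "F 0 0 i = 0" by (rule zero_at_origin_if_inner_le)
  show "G 0 0 i = 0"
    using drift[of 0 0] q by (simp add: mult_le_0_iff)
qed

lemma lipschitz_linear_growth:
  assumes "lipschitz_coeff N K \<phi>" "i \<in> {1..N}" "\<phi> 0 0 i = 0"
  shows "(norm (\<phi> x y i))\<^sup>2 \<le> K * ((norm x)\<^sup>2 + (norm y)\<^sup>2)"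
proof -
  have "(norm (\<phi> x y i - \<phi> 0 0 i))\<^sup>2 \<le> K * ((norm (x - 0))\<^sup>2 + (norm (y - 0))\<^sup>2)"
    using assms(1,2) unfolding lipschitz_coeff_def by blast
  then show ?thesis using assms(3) by simp
qed

text \<open>Near the origin the truncation is inactive and the local Lipschitz condition applies; elsewhere
  \<open>h \<Delta>\<close> bounds the truncated coefficient and \<open>1 \<le> (norm x)\<^sup>2 + (norm y)\<^sup>2\<close>.\<close>

lemma truncated_coeff_linear_growth:
  fixes \<phi> :: "real ^ 'n \<Rightarrow> real ^ 'n \<Rightarrow> nat \<Rightarrow> 'b::real_normed_vector"
  assumes lip: "poly_lipschitz_coeff N K \<rho> \<phi>" "0 \<le> \<rho>" "0 \<le> K" "i \<in> {1..N}" and zero: "\<phi> 0 0 i = 0"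
    and R: "1 \<le> the_inv_into {0..} \<mu> (h \<Delta>)"
    and bd: "\<And>x y. max (norm x) (norm y) \<le> the_inv_into {0..} \<mu> (h \<Delta>) \<Longrightarrow> norm (\<phi> x y i) \<le> h \<Delta>"
  shows "(norm (truncated_coeff \<mu> h \<Delta> \<phi> x y i))\<^sup>2 \<le> (5 * K + (h \<Delta>)\<^sup>2) * ((norm x)\<^sup>2 + (norm y)\<^sup>2)"
proof (cases "norm x \<le> 1 \<and> norm y \<le> 1")
  case True
  then have eq: "truncated_coeff \<mu> h \<Delta> \<phi> x y i = \<phi> x y i"
    using R by (simp add: truncated_coeff_def truncation_eq_self)
  have "(norm (\<phi> x y i - \<phi> 0 0 i))\<^sup>2
      \<le> K * (1 + rpow (norm x) \<rho> + rpow (norm y) \<rho> + rpow (norm (0 :: real ^ 'n)) \<rho> + rpow (norm (0 :: real ^ 'n)) \<rho>)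
        * ((norm (x - 0))\<^sup>2 + (norm (y - 0))\<^sup>2)"
    using lip(1,4) unfolding poly_lipschitz_coeff_def by blast
  \<comment> \<open>The 5 counts the summands of the weight, each at most 1 on the unit ball;
    \<open>rpow 0 \<rho>\<close> is 1 for \<open>\<rho> = 0\<close> and 0 otherwise.\<close>
  also have "\<dots> \<le> (K * 5) * ((norm (x - 0))\<^sup>2 + (norm (y - 0))\<^sup>2)"
    using True lip(2,3) rpow_le_1[of \<rho> "norm x"] rpow_le_1[of \<rho> "norm y"] rpow_le_1[of \<rho> 0]
    by (intro mult_right_mono mult_left_mono) auto
  also have "\<dots> \<le> (5 * K + (h \<Delta>)\<^sup>2) * ((norm x)\<^sup>2 + (norm y)\<^sup>2)"
    unfolding diff_zero by (intro mult_right_mono) auto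
  finally show ?thesis by (simp add: eq zero)
next
  case False
  have "max (norm (truncation \<mu> h \<Delta> x)) (norm (truncation \<mu> h \<Delta> y)) \<le> the_inv_into {0..} \<mu> (h \<Delta>)"
    using R by (subst (1 2) norm_truncation_eq) auto
  then have "(norm (truncated_coeff \<mu> h \<Delta> \<phi> x y i))\<^sup>2 \<le> (h \<Delta>)\<^sup>2 * 1"
    unfolding truncated_coeff_def mult_1_right by (intro power_mono bd norm_ge_zero)
  also have "\<dots> \<le> (5 * K + (h \<Delta>)\<^sup>2) * ((norm x)\<^sup>2 + (norm y)\<^sup>2)"
  proof (rule mult_mono)
    show "1 \<le> (norm x)\<^sup>2 + (norm y)\<^sup>2"
      using False one_le_power[of "norm x" 2] one_le_power[of "norm y" 2]
        zero_le_power2[of "norm x"] zero_le_power2[of "norm y"] by linarith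
  qed (use lip in auto)
  finally show ?thesis .
qed

lemma norm_add_sq_le:
  fixes u v :: "'a::real_normed_vector"
  shows "(norm (u + v))\<^sup>2 \<le> 2 * (norm u)\<^sup>2 + 2 * (norm v)\<^sup>2"
proof -
  have "(norm (u + v))\<^sup>2 \<le> (norm u + norm v)\<^sup>2"
    by (intro power_mono norm_triangle_ineq norm_ge_zero)
  also have "\<dots> \<le> 2 * (norm u)\<^sup>2 + 2 * (norm v)\<^sup>2"
    using sum_squares_bound[of "norm u" "norm v"] by (simp add: power2_sum)
  finally show ?thesis .
qed

section \<open>The one-step drift estimate for small step sizes\<close>

text \<open>The first stability inequality controls the untruncated part,
  \<open>truncated_drift_le\<close> the truncated one with \<open>2 * l3\<close>, and the Euler term
  \<open>\<Delta> * (norm (f \<Delta> x y i))\<^sup>2\<close> costs one \<open>\<epsilon>\<close> in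
  each of \<open>a\<close> and \<open>b\<close>. The bound \<open>\<Delta> * a \<le> 1\<close> is
  there to keep the factor \<open>1 - \<Delta> * a\<close> of the moment recursion
  nonnegative.\<close>

lemma ptem_drift_le:
  fixes F1 F :: "real ^ 'n \<Rightarrow> real ^ 'n \<Rightarrow> nat \<Rightarrow> real ^ 'n"
    and G1 G :: "real ^ 'n \<Rightarrow> real ^ 'n \<Rightarrow> nat \<Rightarrow> real ^ 'm ^ 'n"
    and K1 \<rho> \<delta>b l1 l2 l3 l4 \<epsilon> \<Delta>s :: real
  assumes A_const: "0 < K1" "0 \<le> \<rho>"
    and A_lip: "lipschitz_coeff N K1 F1" "lipschitz_coeff N K1 G1"
    and A_poly: "poly_lipschitz_coeff N K1 \<rho> F" "poly_lipschitz_coeff N K1 \<rho> G"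
    and S_cond: "stability_condition N \<theta> \<delta>b l1 l2 l3 l4 F1 G1 F G" and db: "\<delta>b < 1"
    and mu: "growth_function N F G \<mu>"
    and step: "\<Delta>s \<in> {0<..1}" "step_function \<Delta>s \<mu> h"
    and eps: "0 < \<epsilon>"
  defines "f \<equiv> \<lambda>\<Delta> x y i. F1 x y i + truncated_coeff \<mu> h \<Delta> F x y i"
    and "g \<equiv> \<lambda>\<Delta> x y i. G1 x y i + truncated_coeff \<mu> h \<Delta> G x y i"
    and "a \<equiv> l1 - 2 * l3 - \<epsilon>" and "b \<equiv> (1 - \<delta>b) * (l2 + l4) + \<epsilon>"
  shows "\<exists>\<Delta>b\<in>{0<..\<Delta>s}. \<forall>\<Delta>\<in>{0<..\<Delta>b}. \<Delta> * a \<le> 1 \<and> (\<exists>L\<ge>0. \<forall>i\<in>{1..N}. \<forall>x y.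
     (norm (f \<Delta> x y i))\<^sup>2 \<le> L * ((norm x)\<^sup>2 + (norm y)\<^sup>2) \<and>
     (norm (g \<Delta> x y i))\<^sup>2 \<le> L * ((norm x)\<^sup>2 + (norm y)\<^sup>2) \<and>
     2 * (x \<bullet> f \<Delta> x y i) + (norm (g \<Delta> x y i))\<^sup>2 + \<Delta> * (norm (f \<Delta> x y i))\<^sup>2
       \<le> - a * (norm x)\<^sup>2 + b * (norm y)\<^sup>2)"
proof -
  obtain q1 q2 :: real where q: "0 < q1" "0 < q2"
    and d1: "\<And>i x y. i \<in> {1..N} \<Longrightarrow> 2 * (x \<bullet> F1 x y i) + q1 * (norm (G1 x y i))\<^sup>2
       \<le> - l1 * (norm x)\<^sup>2 + l2 * (1 - \<delta>b) * (norm y)\<^sup>2"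
    and d2: "\<And>i x y. i \<in> {1..N} \<Longrightarrow> 2 * (x \<bullet> F x y i) + q2 * (norm (G x y i))\<^sup>2
       \<le> l3 * (norm x)\<^sup>2 + l4 * (1 - \<delta>b) * (norm y)\<^sup>2"
    and young: "\<And>i x y x' y'. i \<in> {1..N} \<Longrightarrow>
       (norm (G1 x y i + G x' y' i))\<^sup>2 \<le> q1 * (norm (G1 x y i))\<^sup>2 + q2 * (norm (G x' y' i))\<^sup>2"
    using stability_condition_weights[OF S_cond] by blast
  have l: "0 \<le> l4 * (1 - \<delta>b)" "l4 * (1 - \<delta>b) \<le> l3"
  proof -
    have "2 * (1 - \<delta>b) * l4 \<le> 2 * l3" "0 \<le> 2 * (1 - \<delta>b) * l4"
      using S_cond unfolding stability_condition_def by blast+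
    then show "0 \<le> l4 * (1 - \<delta>b)" "l4 * (1 - \<delta>b) \<le> l3" by (simp_all add: algebra_simps)
  qed
  have A_lip': "poly_lipschitz_coeff N K1 0 F1"
    using A_const A_lip by (intro lipschitz_imp_poly_lipschitz) auto
  have F10: "F1 0 0 i = 0" and G10: "G1 0 0 i = 0" if "i \<in> {1..N}" for i
    using vanish_at_origin_if_drift_le[where F = F1 and G = G1, OF A_lip' order_refl that q(1) d1[OF that]]
    by simp_all
  have F0: "F 0 0 i = 0" and G0: "G 0 0 i = 0" if "i \<in> {1..N}" for i
    using vanish_at_origin_if_drift_le[where F = F and G = G, OF A_poly(1) A_const(2) that q(2) d2[OF that]] by simp_all
  \<comment> \<open>The second entry yields \<open>\<Delta> * a \<le> 1\<close> for either sign of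
    \<open>a\<close>; the third yields
    \<open>(12 * K1 + 2) * sqrt \<Delta> \<le> \<epsilon>\<close>.\<close>
  define \<Delta>b where "\<Delta>b = min \<Delta>s (min (1 / (\<bar>a\<bar> + 1)) ((\<epsilon> / (12 * K1 + 2))\<^sup>2))"
  have "\<Delta>b \<in> {0<..\<Delta>s}"
    using step(1) eps A_const by (simp add: \<Delta>b_def)
  moreover have "\<Delta> * a \<le> 1 \<and> (\<exists>L\<ge>0. \<forall>i\<in>{1..N}. \<forall>x y.
     (norm (f \<Delta> x y i))\<^sup>2 \<le> L * ((norm x)\<^sup>2 + (norm y)\<^sup>2) \<and>
     (norm (g \<Delta> x y i))\<^sup>2 \<le> L * ((norm x)\<^sup>2 + (norm y)\<^sup>2) \<and>
     2 * (x \<bullet> f \<Delta> x y i) + (norm (g \<Delta> x y i))\<^sup>2 + \<Delta> * (norm (f \<Delta> x y i))\<^sup>2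
       \<le> - a * (norm x)\<^sup>2 + b * (norm y)\<^sup>2)" if \<Delta>: "\<Delta> \<in> {0<..\<Delta>b}" for \<Delta>
  \<comment> \<open>The witness is \<open>2 * K1 + 2 * (5 * K1 + (h \<Delta>)\<^sup>2)\<close>, from
    the squared norm of a sum. It may grow as \<open>\<Delta>\<close> shrinks, since integrability
    is wanted at a fixed step size.\<close>
  proof (intro conjI exI[of _ "12 * K1 + 2 * (h \<Delta>)\<^sup>2"] ballI allI)
    have \<Delta>s: "\<Delta> \<in> {0<..\<Delta>s}" and \<Delta>0: "0 < \<Delta>" and \<Delta>1: "\<Delta> \<le> 1"
      and \<Delta>a: "\<Delta> \<le> 1 / (\<bar>a\<bar> + 1)" and \<Delta>e: "\<Delta> \<le> (\<epsilon> / (12 * K1 + 2))\<^sup>2"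
      using \<Delta> step(1) by (auto simp: \<Delta>b_def)
    have "\<Delta> * a \<le> \<Delta> * (\<bar>a\<bar> + 1)"
      using \<Delta>0 by (intro mult_left_mono) auto
    also have "\<dots> \<le> 1"
      using \<Delta>a by (simp add: pos_le_divide_eq)
    finally show "\<Delta> * a \<le> 1" .
    show "0 \<le> 12 * K1 + 2 * (h \<Delta>)\<^sup>2" using A_const by simp
    note R = truncation_radius[OF mu step(2) \<Delta>s]
    have bd: "norm (F x y i) \<le> h \<Delta>" "norm (G x y i) \<le> h \<Delta>"
      if "max (norm x) (norm y) \<le> the_inv_into {0..} \<mu> (h \<Delta>)" "i \<in> {1..N}" for x y i
    proof -
      have "max (norm (F x y i)) (norm (G x y i)) \<le> \<mu> (the_inv_into {0..} \<mu> (h \<Delta>))"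
        using mu that R(1) unfolding growth_function_def by blast
      then show "norm (F x y i) \<le> h \<Delta>" "norm (G x y i) \<le> h \<Delta>" using R(2) by auto
    qed
    \<comment> \<open>Squaring \<open>\<Delta> powr (1 / 4) * h \<Delta> \<le> 1\<close> gives
      \<open>\<Delta> * (h \<Delta>)\<^sup>2 \<le> sqrt \<Delta>\<close>, and
      \<open>\<Delta> \<le> sqrt \<Delta>\<close> since \<open>\<Delta> \<le> 1\<close>.\<close>
    have small: "\<Delta> * (12 * K1 + 2 * (h \<Delta>)\<^sup>2) \<le> \<epsilon>"
    proof -
      have "0 < h \<Delta>" "\<Delta> powr (1 / 4) * h \<Delta> \<le> 1"
        using step(2) \<Delta>s unfolding step_function_def by blast+
      then have "(\<Delta> powr (1 / 4) * h \<Delta>)\<^sup>2 \<le> 1\<^sup>2"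
        by (intro power_mono) auto
      then have "sqrt \<Delta> * (h \<Delta>)\<^sup>2 \<le> 1"
        using \<Delta>0 by (simp add: power_mult_distrib powr_half_sqrt powr_power)
      then have "sqrt \<Delta> * (sqrt \<Delta> * (h \<Delta>)\<^sup>2) \<le> sqrt \<Delta> * 1"
        using \<Delta>0 by (intro mult_left_mono) auto
      then have "\<Delta> * (h \<Delta>)\<^sup>2 \<le> sqrt \<Delta>"
        using \<Delta>0 by (simp add: mult.assoc[symmetric])
      moreover have "\<Delta> \<le> sqrt \<Delta>"
        using \<Delta>0 \<Delta>1 by (intro real_le_rsqrt) (simp add: power2_eq_square mult_le_one)
      ultimately have "12 * K1 * \<Delta> + 2 * (\<Delta> * (h \<Delta>)\<^sup>2) \<le> 12 * K1 * sqrt \<Delta> + 2 * sqrt \<Delta>"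
        using A_const by (intro add_mono mult_left_mono) auto
      then have "\<Delta> * (12 * K1 + 2 * (h \<Delta>)\<^sup>2) \<le> (12 * K1 + 2) * sqrt \<Delta>"
        by (simp add: algebra_simps)
      also have "\<dots> \<le> (12 * K1 + 2) * (\<epsilon> / (12 * K1 + 2))"
        using A_const eps \<Delta>e by (intro mult_left_mono real_le_lsqrt) auto
      also have "\<dots> = \<epsilon>" using A_const by simp
      finally show ?thesis .
    qed
    fix i and x y :: "real ^ 'n" assume i: "i \<in> {1..N}"
    define S where "S = (norm x)\<^sup>2 + (norm y)\<^sup>2"
    let ?T = "truncation \<mu> h \<Delta>"
    have gF: "(norm (truncated_coeff \<mu> h \<Delta> F x y i))\<^sup>2 \<le> (5 * K1 + (h \<Delta>)\<^sup>2) * S"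
      unfolding S_def using A_poly(1) A_const i F0[OF i] R(1) bd(1)[OF _ i]
      by (intro truncated_coeff_linear_growth) auto
    have gG: "(norm (truncated_coeff \<mu> h \<Delta> G x y i))\<^sup>2 \<le> (5 * K1 + (h \<Delta>)\<^sup>2) * S"
      unfolding S_def using A_poly(2) A_const i G0[OF i] R(1) bd(2)[OF _ i]
      by (intro truncated_coeff_linear_growth) auto
    have gF1: "(norm (F1 x y i))\<^sup>2 \<le> K1 * S" and gG1: "(norm (G1 x y i))\<^sup>2 \<le> K1 * S"
      unfolding S_def using A_lip i F10 G10 by (auto intro!: lipschitz_linear_growth)
    show fS: "(norm (f \<Delta> x y i))\<^sup>2 \<le> (12 * K1 + 2 * (h \<Delta>)\<^sup>2) * ((norm x)\<^sup>2 + (norm y)\<^sup>2)"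
      using norm_add_sq_le[of "F1 x y i" "truncated_coeff \<mu> h \<Delta> F x y i"] gF gF1
      unfolding f_def S_def[symmetric] by (simp add: algebra_simps)
    show "(norm (g \<Delta> x y i))\<^sup>2 \<le> (12 * K1 + 2 * (h \<Delta>)\<^sup>2) * ((norm x)\<^sup>2 + (norm y)\<^sup>2)"
      using norm_add_sq_le[of "G1 x y i" "truncated_coeff \<mu> h \<Delta> G x y i"] gG gG1
      unfolding g_def S_def[symmetric] by (simp add: algebra_simps)
    have "\<Delta> * (norm (f \<Delta> x y i))\<^sup>2 \<le> \<Delta> * ((12 * K1 + 2 * (h \<Delta>)\<^sup>2) * S)"
      using fS \<Delta>0 by (intro mult_left_mono) (auto simp: S_def)
    also have "\<dots> \<le> \<epsilon> * S"
      unfolding mult.assoc[symmetric] using small by (intro mult_right_mono) (auto simp: S_def)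
    finally have t1: "\<Delta> * (norm (f \<Delta> x y i))\<^sup>2 \<le> \<epsilon> * (norm x)\<^sup>2 + \<epsilon> * (norm y)\<^sup>2"
      by (simp add: S_def distrib_left)
    have t2: "2 * (x \<bullet> F (?T x) (?T y) i) + q2 * (norm (G (?T x) (?T y) i))\<^sup>2
        \<le> 2 * l3 * (norm x)\<^sup>2 + l4 * (1 - \<delta>b) * (norm y)\<^sup>2"
      using d2[OF i] q l R(1)
      by (intro truncated_drift_le[where F = "\<lambda>x y. F x y i" and G = "\<lambda>x y. G x y i"]) auto
    \<comment> \<open>The weights divide the noise between the two stability inequalities;
      \<open>young\<close> allows different arguments because only \<open>G\<close> is evaluated at
      truncated points.\<close>
    have "2 * (x \<bullet> f \<Delta> x y i) + (norm (g \<Delta> x y i))\<^sup>2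
        \<le> (2 * (x \<bullet> F1 x y i) + q1 * (norm (G1 x y i))\<^sup>2)
          + (2 * (x \<bullet> F (?T x) (?T y) i) + q2 * (norm (G (?T x) (?T y) i))\<^sup>2)"
      using young[OF i, of x y "?T x" "?T y"]
      by (simp add: f_def g_def truncated_coeff_def inner_add_right)
    also have "\<dots> \<le> (- l1 * (norm x)\<^sup>2 + l2 * (1 - \<delta>b) * (norm y)\<^sup>2)
        + (2 * l3 * (norm x)\<^sup>2 + l4 * (1 - \<delta>b) * (norm y)\<^sup>2)"
      by (intro add_mono d1[OF i] t2)
    finally show "2 * (x \<bullet> f \<Delta> x y i) + (norm (g \<Delta> x y i))\<^sup>2 + \<Delta> * (norm (f \<Delta> x y i))\<^sup>2
        \<le> - a * (norm x)\<^sup>2 + b * (norm y)\<^sup>2"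
      using t1 by (simp add: a_def b_def algebra_simps)
  qed
  ultimately show ?thesis by blast
qed

section \<open>The decay rate\<close>

text \<open>Collecting \<open>\<gamma>\<close> on one side gives \<open>\<phi> \<gamma> = a\<close>
  with \<open>\<phi>\<close> strictly increasing. The upper bound on \<open>\<epsilon>\<close> says
  exactly \<open>b < a\<close>, so \<open>\<phi> 0 < a \<le> \<phi> a\<close> and the only solution
  is positive.\<close>

lemma ex1_decay_root:
  assumes "0 < \<tau>" "0 \<le> (1 - \<delta>b) * (l2 + l4)" "0 < \<epsilon>"
    and "\<epsilon> < 1 / 2 * (l1 - 2 * l3 - (1 - \<delta>b) * (l2 + l4))"
  shows "\<exists>!\<gamma>. decay_root \<tau> \<delta>b l1 l2 l3 l4 \<epsilon> \<gamma>"
proof -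
  define b where "b = (1 - \<delta>b) * (l2 + l4) + \<epsilon>"
  define a where "a = l1 - 2 * l3 - \<epsilon>"
  define \<phi> where "\<phi> = (\<lambda>\<gamma>. b * exp (\<gamma> * \<tau>) + \<gamma>)"
  have b: "0 < b" and ab: "b < a"
    using assms by (auto simp: a_def b_def)
  have root: "decay_root \<tau> \<delta>b l1 l2 l3 l4 \<epsilon> \<gamma> \<longleftrightarrow> 0 < \<gamma> \<and> \<phi> \<gamma> = a" for \<gamma>
    by (auto simp: decay_root_def a_def b_def \<phi>_def)
  have mono: "\<phi> x < \<phi> y" if "x < y" for x y
    using that b assms(1) by (simp add: \<phi>_def add_strict_mono)
  have "\<exists>x\<ge>0. x \<le> a \<and> \<phi> x = a"
    by (rule IVT') (use b ab in \<open>auto simp: \<phi>_def intro!: continuous_intros\<close>)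
  then obtain x where x: "0 \<le> x" "\<phi> x = a" by blast
  then have "0 < x" using ab by (cases "x = 0") (auto simp: \<phi>_def)
  show ?thesis
    unfolding root
  proof (intro ex1I[of _ x])
    fix y assume "0 < y \<and> \<phi> y = a"
    then show "y = x" using mono[of x y] mono[of y x] x by (cases x y rule: linorder_cases) auto
  qed (use x \<open>0 < x\<close> in simp)
qed

section \<open>Measurability of the truncated coefficients\<close>

lemma truncation_measurable [measurable]:
  "(truncation \<mu> h \<Delta> :: real ^ 'n \<Rightarrow> real ^ 'n) \<in> borel_measurable borel"
  unfolding truncation_def by measurable

lemma truncated_coeff_measurable:
  fixes \<phi> :: "real ^ 'n \<Rightarrow> real ^ 'n \<Rightarrow> nat \<Rightarrow> 'b::real_normed_vector"
  assumes [measurable]: "(\<lambda>(x, y). \<phi> x y i) \<in> borel_measurable (borel \<Otimes>\<^sub>M borel)"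
  shows "(\<lambda>(x, y). truncated_coeff \<mu> h \<Delta> \<phi> x y i) \<in> borel_measurable (borel \<Otimes>\<^sub>M borel)"
proof -
  have "(\<lambda>z. (truncation \<mu> h \<Delta> (fst z), truncation \<mu> h \<Delta> (snd z)))
      \<in> (borel \<Otimes>\<^sub>M borel :: ((real ^ 'n) \<times> (real ^ 'n)) measure) \<rightarrow>\<^sub>M borel \<Otimes>\<^sub>M borel"
    by measurable
  from measurable_compose[OF this assms] show ?thesis
    by (simp add: truncated_coeff_def case_prod_beta)
qed

subsection \<open>Decay of the scheme\<close>

text \<open>For a fixed regime this is a composition of measurable maps; the finitely many regimes
  are glued along the events on which \<open>r\<close> is constant.\<close>

lemma measurable_coeff_comp:
  fixes \<phi> :: "real ^ 'n \<Rightarrow> real ^ 'n \<Rightarrow> nat \<Rightarrow> 'b::topological_space"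
  assumes \<phi>: "\<And>i. i \<in> {1..N} \<Longrightarrow> (\<lambda>(x, y). \<phi> x y i) \<in> borel_measurable (borel \<Otimes>\<^sub>M borel)"
    and XY: "X \<in> borel_measurable \<G>" "Y \<in> borel_measurable \<G>"
    and r: "r \<in> measurable \<G> (count_space UNIV)" "\<And>\<omega>. \<omega> \<in> space \<G> \<Longrightarrow> r \<omega> \<in> {1..N}"
  shows "(\<lambda>\<omega>. \<phi> (X \<omega>) (Y \<omega>) (r \<omega>)) \<in> borel_measurable \<G>"
proof (rule measurable_compose_countable'[where I = "{1..N}" and f = "\<lambda>i \<omega>. \<phi> (X \<omega>) (Y \<omega>) i"])
  fix i assume "i \<in> {1..N}"
  from measurable_compose[OF _ \<phi>[OF this], of "\<lambda>\<omega>. (X \<omega>, Y \<omega>)" \<G>] XY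
  show "(\<lambda>\<omega>. \<phi> (X \<omega>) (Y \<omega>) i) \<in> borel_measurable \<G>" by simp
next
  show "r \<in> measurable \<G> (count_space {1..N})"
    using r measurable_sets[OF r(1)] by (subst measurable_count_space_eq2) auto
qed simp

text \<open>A discrete Halanay inequality: the lag is bounded by \<open>\<tau>\<close>, so the induction hypothesis bounds
  the delayed moment by \<open>exp (\<gamma> * \<tau>)\<close> times the bound for the present one, and the equation for the
  rate closes the induction.\<close>

lemma (in prob_space) em_second_moment_decay:
  fixes X :: "int \<Rightarrow> 'a \<Rightarrow> real ^ 'n" and B :: "real \<Rightarrow> 'a \<Rightarrow> real ^ 'm"
    and f :: "real ^ 'n \<Rightarrow> real ^ 'n \<Rightarrow> nat \<Rightarrow> real ^ 'n"
    and g :: "real ^ 'n \<Rightarrow> real ^ 'n \<Rightarrow> nat \<Rightarrow> real ^ 'm ^ 'n"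
  assumes sub: "\<And>t. 0 \<le> t \<Longrightarrow> subalgebra M (\<F> t)"
    and filt: "\<And>s t. 0 \<le> s \<Longrightarrow> s \<le> t \<Longrightarrow> sets (\<F> s) \<subseteq> sets (\<F> t)"
    and bm: "brownian_motion M \<F> B"
    and r: "\<And>t. 0 \<le> t \<Longrightarrow> r t \<in> measurable (\<F> t) (count_space UNIV)"
      "\<And>t \<omega>. 0 \<le> t \<Longrightarrow> \<omega> \<in> space M \<Longrightarrow> r t \<omega> \<in> {1..N}"
    and meas: "\<And>i. i \<in> {1..N} \<Longrightarrow> (\<lambda>(x, y). f x y i) \<in> borel_measurable (borel \<Otimes>\<^sub>M borel)"
      "\<And>i. i \<in> {1..N} \<Longrightarrow> (\<lambda>(x, y). g x y i) \<in> borel_measurable (borel \<Otimes>\<^sub>M borel)"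
    and growth: "\<And>i x y. i \<in> {1..N} \<Longrightarrow> (norm (f x y i))\<^sup>2 \<le> L * ((norm x)\<^sup>2 + (norm y)\<^sup>2)"
      "\<And>i x y. i \<in> {1..N} \<Longrightarrow> (norm (g x y i))\<^sup>2 \<le> L * ((norm x)\<^sup>2 + (norm y)\<^sup>2)"
    and drift: "\<And>i x y. i \<in> {1..N} \<Longrightarrow>
      2 * (x \<bullet> f x y i) + (norm (g x y i))\<^sup>2 + \<Delta> * (norm (f x y i))\<^sup>2 \<le> - a * (norm x)\<^sup>2 + b * (norm y)\<^sup>2"
    and \<Delta>: "0 < \<Delta>" "\<Delta> * a \<le> 1" and b: "0 \<le> b"
    and \<gamma>: "0 \<le> \<gamma>" "b * exp (\<gamma> * \<tau>) \<le> a - \<gamma>"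
    and init: "\<And>k \<omega>. k \<le> 0 \<Longrightarrow> X k \<omega> = c k"
    and lag: "\<And>k. 0 \<le> d k" "\<And>k. of_int (d k) * \<Delta> \<le> \<tau>"
    and step: "\<And>k \<omega>. X (int k + 1) \<omega> = X (int k) \<omega>
      + \<Delta> *\<^sub>R f (X (int k) \<omega>) (X (int k - d k) \<omega>) (r (real k * \<Delta>) \<omega>)
      + g (X (int k) \<omega>) (X (int k - d k) \<omega>) (r (real k * \<Delta>) \<omega>)
          *v (B (real (Suc k) * \<Delta>) \<omega> - B (real k * \<Delta>) \<omega>)"
  shows "\<exists>C\<ge>0. \<forall>k::nat. integrable M (\<lambda>\<omega>. (norm (X (int k) \<omega>))\<^sup>2) \<and>
      expectation (\<lambda>\<omega>. (norm (X (int k) \<omega>))\<^sup>2) \<le> C * exp (- \<gamma> * (real k * \<Delta>))"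
proof -
  \<comment> \<open>The range covers all grid points of \<open>{-\<tau>..0}\<close>, so
    \<open>C\<close> dominates the initial data there; for \<open>k \<le> 0\<close> the exponential
    weight is at least 1.\<close>
  define C where "C = (\<Sum>k\<in>{- \<lceil>\<tau> / \<Delta>\<rceil>..0}. (norm (c k))\<^sup>2)"
  have C0: "0 \<le> C" by (simp add: C_def sum_nonneg)
  \<comment> \<open>\<open>max k 0\<close> assigns the deterministic initial values to time 0 of the
    filtration. Decay is claimed only from \<open>- \<tau>\<close> on, which is as far back as a lag
    can reach.\<close>
  define P where "P = (\<lambda>k. X k \<in> borel_measurable (\<F> (of_int (max k 0) * \<Delta>)) \<and>
      integrable M (\<lambda>\<omega>. (norm (X k \<omega>))\<^sup>2) \<and>
      (- \<tau> \<le> of_int k * \<Delta> \<longrightarrow>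
        expectation (\<lambda>\<omega>. (norm (X k \<omega>))\<^sup>2) \<le> C * exp (- \<gamma> * (of_int k * \<Delta>))))"
  have P_init: "P k" if "k \<le> 0" for k
  proof -
    have X: "X k = (\<lambda>_. c k)" using init[OF that] by auto
    have "(norm (c k))\<^sup>2 \<le> C * exp (- \<gamma> * (of_int k * \<Delta>))" if "- \<tau> \<le> of_int k * \<Delta>"
    proof -
      have "- (\<tau> / \<Delta>) \<le> of_int k"
        using that \<Delta> by (simp add: field_simps)
      then have "- \<lceil>\<tau> / \<Delta>\<rceil> \<le> k" by linarith
      then have "(norm (c k))\<^sup>2 \<le> C * 1"
        using \<open>k \<le> 0\<close> unfolding C_def mult_1_right by (intro member_le_sum) auto
      also have "\<dots> \<le> C * exp (- \<gamma> * (of_int k * \<Delta>))"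
        using \<open>k \<le> 0\<close> \<gamma> \<Delta> C0
        by (intro mult_left_mono) (auto simp: mult_nonneg_nonpos mult_nonpos_nonneg)
      finally show ?thesis .
    qed
    then show ?thesis by (simp add: P_def X prob_space)
  qed
  have P_step: "P (int k + 1)" if IH: "\<And>j. j \<le> int k \<Longrightarrow> P j" for k
  proof -
    define s where "s = real k * \<Delta>"
    define t where "t = real (Suc k) * \<Delta>"
    have s0: "0 \<le> s" and st: "s < t" and ts: "t - s = \<Delta>"
      using \<Delta> by (auto simp: s_def t_def algebra_simps)
    have subs: "subalgebra M (\<F> s)" and subt: "subalgebra M (\<F> t)"
      using sub s0 st by auto
    have subst: "subalgebra (\<F> t) (\<F> s)"
      using subs subt filt[of s t] s0 st by (auto simp: subalgebra_def)
    define x where "x = X (int k)"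
    define y where "y = X (int k - d k)"
    define \<rho> where "\<rho> = r s"
    define dB where "dB = (\<lambda>\<omega>. B t \<omega> - B s \<omega>)"
    define fv where "fv = (\<lambda>\<omega>. f (x \<omega>) (y \<omega>) (\<rho> \<omega>))"
    define gv where "gv = (\<lambda>\<omega>. g (x \<omega>) (y \<omega>) (\<rho> \<omega>))"
    define A where "A = (\<lambda>\<omega>. x \<omega> + \<Delta> *\<^sub>R fv \<omega>)"
    have Xt: "X (int k + 1) = (\<lambda>\<omega>. A \<omega> + gv \<omega> *v dB \<omega>)"
      using step[of k] by (auto simp: A_def fv_def gv_def dB_def x_def y_def \<rho>_def s_def t_def)
    have Px: "P (int k)" and Py: "P (int k - d k)" using IH lag[of k] by auto
    have xm: "x \<in> borel_measurable (\<F> s)"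
      using Px by (simp add: P_def x_def s_def)
    \<comment> \<open>The delayed state belongs to an index not above \<open>k\<close>, hence is
      known at time \<open>s\<close>.\<close>
    have ym: "y \<in> borel_measurable (\<F> s)"
    proof -
      have le: "of_int (max (int k - d k) 0) * \<Delta> \<le> s"
        unfolding s_def using lag(1)[of k] \<Delta> by (intro mult_right_mono) auto
      have ge: "0 \<le> of_int (max (int k - d k) 0) * \<Delta>" using \<Delta> by simp
      have "subalgebra (\<F> s) (\<F> (of_int (max (int k - d k) 0) * \<Delta>))"
        using subs sub[OF ge] filt[OF ge le] by (auto simp: subalgebra_def)
      then show ?thesis
        using Py measurable_from_subalg unfolding P_def y_def by blast
    qed
    have rm: "\<rho> \<in> measurable (\<F> s) (count_space UNIV)" using r(1)[OF s0] by (simp add: \<rho>_def)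
    have rr: "\<rho> \<omega> \<in> {1..N}" if "\<omega> \<in> space M" for \<omega> using r(2)[OF s0 that] by (simp add: \<rho>_def)
    have rr': "\<rho> \<omega> \<in> {1..N}" if "\<omega> \<in> space (\<F> s)" for \<omega>
      using that subs rr by (simp add: subalgebra_def)
    have fm: "fv \<in> borel_measurable (\<F> s)"
      unfolding fv_def by (rule measurable_coeff_comp[OF meas(1) xm ym rm rr'])
    have gm: "gv \<in> borel_measurable (\<F> s)"
      unfolding gv_def by (rule measurable_coeff_comp[OF meas(2) xm ym rm rr'])
    have Am: "A \<in> borel_measurable (\<F> s)"
      unfolding A_def using xm fm by measurable
    have [measurable]: "x \<in> borel_measurable M" "y \<in> borel_measurable M" "fv \<in> borel_measurable M"
      "gv \<in> borel_measurable M" "A \<in> borel_measurable M"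
      using xm ym fm gm Am subs measurable_from_subalg by blast+
    have Bt: "B t \<in> borel_measurable (\<F> t)" and Bs: "B s \<in> borel_measurable (\<F> s)"
      using bm s0 st unfolding brownian_motion_def by auto
    have dBm: "dB \<in> borel_measurable (\<F> t)"
      unfolding dB_def using Bt measurable_from_subalg[OF subst Bs] by measurable
    have ix: "integrable M (\<lambda>\<omega>. (norm (x \<omega>))\<^sup>2)" and iy: "integrable M (\<lambda>\<omega>. (norm (y \<omega>))\<^sup>2)"
      using Px Py by (simp_all add: P_def x_def y_def)
    have dom: "integrable M (\<lambda>\<omega>. L * ((norm (x \<omega>))\<^sup>2 + (norm (y \<omega>))\<^sup>2))"
      using ix iy by simp
    have iF: "integrable M (\<lambda>\<omega>. (norm (fv \<omega>))\<^sup>2)"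
    proof (rule Bochner_Integration.integrable_bound[OF dom])
      show "AE \<omega> in M. norm ((norm (fv \<omega>))\<^sup>2) \<le> norm (L * ((norm (x \<omega>))\<^sup>2 + (norm (y \<omega>))\<^sup>2))"
        using growth(1)[OF rr] by (intro AE_I2) (auto simp: fv_def intro: order_trans[OF _ abs_ge_self])
    qed measurable
    have ig: "integrable M (\<lambda>\<omega>. (norm (gv \<omega>))\<^sup>2)"
    proof (rule Bochner_Integration.integrable_bound[OF dom])
      show "AE \<omega> in M. norm ((norm (gv \<omega>))\<^sup>2) \<le> norm (L * ((norm (x \<omega>))\<^sup>2 + (norm (y \<omega>))\<^sup>2))"
        using growth(2)[OF rr] by (intro AE_I2) (auto simp: gv_def intro: order_trans[OF _ abs_ge_self])
    qed measurable
    have iA: "integrable M (\<lambda>\<omega>. (norm (A \<omega>))\<^sup>2)"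
    proof (rule Bochner_Integration.integrable_bound)
      show "integrable M (\<lambda>\<omega>. 2 * (norm (x \<omega>))\<^sup>2 + 2 * (\<Delta>\<^sup>2 * (norm (fv \<omega>))\<^sup>2))"
        using ix iF by simp
      have "(norm (A \<omega>))\<^sup>2 \<le> 2 * (norm (x \<omega>))\<^sup>2 + 2 * (\<Delta>\<^sup>2 * (norm (fv \<omega>))\<^sup>2)" for \<omega>
        using norm_add_sq_le[of "x \<omega>" "\<Delta> *\<^sub>R fv \<omega>"] by (simp add: A_def power_mult_distrib)
      then show "AE \<omega> in M. norm ((norm (A \<omega>))\<^sup>2)
          \<le> norm (2 * (norm (x \<omega>))\<^sup>2 + 2 * (\<Delta>\<^sup>2 * (norm (fv \<omega>))\<^sup>2))"
        by (auto intro!: AE_I2)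
    qed measurable
    have ind: "indep_set (sets (\<F> s)) {dB -` S \<inter> space M | S. S \<in> sets borel}"
      using bm s0 st unfolding brownian_motion_def dB_def by blast
    have hb: "has_bochner_integral M (\<lambda>\<omega>. (norm (X (int k + 1) \<omega>))\<^sup>2)
        (expectation (\<lambda>\<omega>. (norm (A \<omega>))\<^sup>2) + \<Delta> * expectation (\<lambda>\<omega>. (norm (gv \<omega>))\<^sup>2))"
      unfolding Xt
    proof (rule has_second_moment_affine[OF subs Am iA gm ig measurable_from_subalg[OF subt dBm] ind])
      show "has_bochner_integral M (\<lambda>\<omega>. dB \<omega> $ j) 0" for j
        unfolding dB_def by (rule brownian_increment_moments[OF bm s0 st])
      show "has_bochner_integral M (\<lambda>\<omega>. dB \<omega> $ j * dB \<omega> $ l) (if j = l then \<Delta> else 0)" for j l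
        unfolding dB_def ts[symmetric] by (rule brownian_increment_moments[OF bm s0 st])
    qed
    have "expectation (\<lambda>\<omega>. (norm (X (int k + 1) \<omega>))\<^sup>2)
        = expectation (\<lambda>\<omega>. (norm (A \<omega>))\<^sup>2 + \<Delta> * (norm (gv \<omega>))\<^sup>2)"
      using hb iA ig by (simp add: has_bochner_integral_iff)
    also have "\<dots> \<le> expectation (\<lambda>\<omega>. (1 - \<Delta> * a) * (norm (x \<omega>))\<^sup>2 + \<Delta> * b * (norm (y \<omega>))\<^sup>2)"
    proof (rule integral_mono)
      fix \<omega> assume "\<omega> \<in> space M"
      have "(norm (A \<omega>))\<^sup>2 + \<Delta> * (norm (gv \<omega>))\<^sup>2
          = (norm (x \<omega>))\<^sup>2 + \<Delta> * (2 * (x \<omega> \<bullet> fv \<omega>) + (norm (gv \<omega>))\<^sup>2 + \<Delta> * (norm (fv \<omega>))\<^sup>2)"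
        unfolding A_def power2_norm_eq_inner
        by (simp add: inner_add inner_commute algebra_simps)
      also have "\<dots> \<le> (norm (x \<omega>))\<^sup>2 + \<Delta> * (- a * (norm (x \<omega>))\<^sup>2 + b * (norm (y \<omega>))\<^sup>2)"
        unfolding fv_def gv_def using drift rr[OF \<open>\<omega> \<in> space M\<close>] \<Delta>
        by (intro add_left_mono mult_left_mono) auto
      finally show "(norm (A \<omega>))\<^sup>2 + \<Delta> * (norm (gv \<omega>))\<^sup>2
          \<le> (1 - \<Delta> * a) * (norm (x \<omega>))\<^sup>2 + \<Delta> * b * (norm (y \<omega>))\<^sup>2"
        by (simp add: algebra_simps)
    qed (use iA ig ix iy in auto)
    also have "\<dots> = (1 - \<Delta> * a) * expectation (\<lambda>\<omega>. (norm (x \<omega>))\<^sup>2)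
        + \<Delta> * b * expectation (\<lambda>\<omega>. (norm (y \<omega>))\<^sup>2)"
      using ix iy by simp
    \<comment> \<open>Both coefficients are nonnegative, the first by
      \<open>\<Delta> * a \<le> 1\<close>, so the induction bounds for the present and the delayed
      moment may be inserted.\<close>
    also have "\<dots> \<le> (1 - \<Delta> * a) * (C * exp (- \<gamma> * s)) + \<Delta> * b * (C * exp (- \<gamma> * s) * exp (\<gamma> * \<tau>))"
    proof (intro add_mono mult_left_mono)
      have \<tau>0: "0 \<le> \<tau>"
      proof -
        have "0 \<le> of_int (d k) * \<Delta>" using lag(1)[of k] \<Delta> by simp
        then show ?thesis using lag(2)[of k] by linarith
      qed
      then show "expectation (\<lambda>\<omega>. (norm (x \<omega>))\<^sup>2) \<le> C * exp (- \<gamma> * s)"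
        using Px s0 by (simp add: P_def x_def s_def)
      have ge: "s - \<tau> \<le> of_int (int k - d k) * \<Delta>"
        using lag(2)[of k] by (simp add: s_def algebra_simps)
      then have "- \<tau> \<le> of_int (int k - d k) * \<Delta>" using s0 by linarith
      then have "expectation (\<lambda>\<omega>. (norm (y \<omega>))\<^sup>2) \<le> C * exp (- \<gamma> * (of_int (int k - d k) * \<Delta>))"
        using Py unfolding P_def y_def by blast
      also have "\<dots> \<le> C * exp (- \<gamma> * s + \<gamma> * \<tau>)"
        using mult_left_mono[OF ge \<gamma>(1)] C0 by (intro mult_left_mono) (auto simp: algebra_simps)
      finally show "expectation (\<lambda>\<omega>. (norm (y \<omega>))\<^sup>2) \<le> C * exp (- \<gamma> * s) * exp (\<gamma> * \<tau>)"
        by (simp only: exp_add mult.assoc)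
    qed (use \<Delta> b in auto)
    also have "\<dots> = C * exp (- \<gamma> * s) * (1 + \<Delta> * (b * exp (\<gamma> * \<tau>) - a))"
      by (simp add: algebra_simps)
    \<comment> \<open>The rate inequality makes the factor at most
      \<open>1 - \<gamma> * \<Delta>\<close>, and \<open>1 - u \<le> exp (- u)\<close> restores the
      exponential without loss in the rate.\<close>
    also have "\<dots> \<le> C * exp (- \<gamma> * s) * exp (- \<gamma> * \<Delta>)"
    proof (rule mult_left_mono)
      have "1 + \<Delta> * (b * exp (\<gamma> * \<tau>) - a) \<le> 1 + \<Delta> * (- \<gamma>)"
        using \<gamma>(2) \<Delta> by (intro add_left_mono mult_left_mono) auto
      also have "\<dots> \<le> exp (- \<gamma> * \<Delta>)"
        using exp_ge_add_one_self[of "- \<gamma> * \<Delta>"] by (simp add: mult.commute)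
      finally show "1 + \<Delta> * (b * exp (\<gamma> * \<tau>) - a) \<le> exp (- \<gamma> * \<Delta>)" .
    qed (use C0 in simp)
    also have "\<dots> = C * exp (- \<gamma> * t)"
      using ts by (simp add: mult.assoc exp_add[symmetric] algebra_simps)
    finally have decay: "expectation (\<lambda>\<omega>. (norm (X (int k + 1) \<omega>))\<^sup>2) \<le> C * exp (- \<gamma> * t)" .
    have tk: "of_int (max (int k + 1) 0) * \<Delta> = t" "of_int (int k + 1) * \<Delta> = t"
      by (simp_all add: t_def max_def)
    have "X (int k + 1) \<in> borel_measurable (\<F> t)"
      unfolding Xt
    proof (rule borel_measurable_add)
      show "A \<in> borel_measurable (\<F> t)" by (rule measurable_from_subalg[OF subst Am])
      have gt: "gv \<in> borel_measurable (\<F> t)" by (rule measurable_from_subalg[OF subst gm])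
      have "continuous_on UNIV (\<lambda>z :: (real ^ 'm ^ 'n) \<times> (real ^ 'm). fst z *v snd z)"
        unfolding matrix_vector_mult_def
        by (intro continuous_intros)
      from borel_measurable_continuous_onI[OF this]
      have "(\<lambda>z :: (real ^ 'm ^ 'n) \<times> (real ^ 'm). fst z *v snd z) \<in> borel_measurable (borel \<Otimes>\<^sub>M borel)"
        by (simp add: borel_prod)
      from measurable_compose[OF measurable_Pair[OF gt dBm] this]
      show "(\<lambda>\<omega>. gv \<omega> *v dB \<omega>) \<in> borel_measurable (\<F> t)" by simp
    qed
    then show ?thesis
      unfolding P_def tk using hb decay by (auto simp: has_bochner_integral_iff)
  qed
  \<comment> \<open>Strong induction: the delayed index may be any earlier one, negative ones
    included.\<close>
  have "\<forall>j\<le>int k. P j" for k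
  proof (induction k)
    case 0
    then show ?case using P_init by simp
  next
    case (Suc k)
    show ?case
    proof (intro allI impI)
      fix j assume "j \<le> int (Suc k)"
      then consider "j \<le> int k" | "j = int k + 1" by linarith
      then show "P j" using Suc P_step[of k] by cases auto
    qed
  qed
  then have Pk: "P (int k)" for k by blast
  have "\<tau> \<ge> 0"
  proof -
    have "0 \<le> of_int (d 0) * \<Delta>" using lag(1)[of 0] \<Delta> by simp
    then show ?thesis using lag(2)[of 0] by linarith
  qed
  then have "- \<tau> \<le> real k * \<Delta>" for k
    using \<Delta> by (smt (verit) mult_nonneg_nonneg of_nat_0_le_iff)
  then show ?thesis
    using C0 Pk unfolding P_def by (intro exI[of _ C]) simp
qed

section \<open>From moment decay to pathwise decay\<close>

text \<open>Weighting by \<open>exp (\<kappa> * (real k * \<Delta>))\<close> leaves expectations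
  below a geometric sequence of ratio \<open>q < 1\<close>. The series of the \<open>Z k\<close>
  thus has finite expectation and is almost surely finite, so each path has a constant
  \<open>D\<close> above all its terms; taking logarithms, \<open>ln D\<close> disappears after
  division by \<open>k\<close>.\<close>

lemma (in prob_space) limsup_ln_le_if_exp_moment:
  fixes X :: "nat \<Rightarrow> 'a \<Rightarrow> 'b::{real_normed_vector, second_countable_topology}"
  assumes int: "\<And>k. integrable M (\<lambda>\<omega>. (norm (X k \<omega>))\<^sup>2)"
    and le: "\<And>k. expectation (\<lambda>\<omega>. (norm (X k \<omega>))\<^sup>2) \<le> C * exp (- \<gamma> * (real k * \<Delta>))"
    and \<Delta>: "0 < \<Delta>" and \<epsilon>: "0 < \<epsilon>"
  shows "AE \<omega> in M. limsup (\<lambda>k. ereal (1 / (real k * \<Delta>)) * ext_ln (norm (X k \<omega>))) \<le> ereal (- \<gamma> / 2 + \<epsilon>)"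
proof -
  define \<kappa> where "\<kappa> = \<gamma> - 2 * \<epsilon>"
  define Z where "Z = (\<lambda>k \<omega>. exp (\<kappa> * (real k * \<Delta>)) * (norm (X k \<omega>))\<^sup>2)"
  have iZ: "integrable M (Z k)" for k
    unfolding Z_def using int by simp
  have nZ: "0 \<le> Z k \<omega>" for k \<omega> by (simp add: Z_def)
  have C0: "0 \<le> C"
    using order_trans[OF integral_nonneg_AE le[of 0]] by simp
  define q where "q = exp (- (2 * \<epsilon> * \<Delta>))"
  have q: "0 < q" "q < 1" using \<epsilon> \<Delta> by (auto simp: q_def)
  have EZ: "expectation (Z k) \<le> C * q ^ k" for k
  proof -
    have "expectation (Z k) = exp (\<kappa> * (real k * \<Delta>)) * expectation (\<lambda>\<omega>. (norm (X k \<omega>))\<^sup>2)"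
      by (simp add: Z_def)
    also have "\<dots> \<le> exp (\<kappa> * (real k * \<Delta>)) * (C * exp (- \<gamma> * (real k * \<Delta>)))"
      by (intro mult_left_mono le) simp
    also have "\<dots> = C * exp (real k * (- (2 * \<epsilon> * \<Delta>)))"
      by (simp add: \<kappa>_def exp_add[symmetric] algebra_simps)
    also have "\<dots> = C * q ^ k"
      by (simp only: q_def exp_of_nat_mult)
    finally show ?thesis .
  qed
  have "(\<integral>\<^sup>+ \<omega>. (\<Sum>k. ennreal (Z k \<omega>)) \<partial>M) = (\<Sum>k. \<integral>\<^sup>+ \<omega>. ennreal (Z k \<omega>) \<partial>M)"
    using iZ by (intro nn_integral_suminf) auto
  also have "\<dots> = (\<Sum>k. ennreal (expectation (Z k)))"
    using iZ nZ by (simp add: nn_integral_eq_integral)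
  also have "\<dots> \<le> (\<Sum>k. ennreal (C * q ^ k))"
    using EZ by (intro suminf_le) (auto intro: ennreal_leI)
  also have "\<dots> < \<infinity>"
  proof -
    have "summable (\<lambda>k. C * q ^ k)"
      using q by (intro summable_mult summable_geometric) simp
    then show ?thesis
      using C0 q by (simp add: ennreal_suminf_neq_top less_top[symmetric])
  qed
  finally have "(\<integral>\<^sup>+ \<omega>. (\<Sum>k. ennreal (Z k \<omega>)) \<partial>M) \<noteq> \<infinity>"
    by simp
  then have "AE \<omega> in M. (\<Sum>k. ennreal (Z k \<omega>)) \<noteq> \<infinity>"
    using iZ by (intro nn_integral_PInf_AE) auto
  then show ?thesis
  proof eventually_elim
    fix \<omega> assume fin: "(\<Sum>k. ennreal (Z k \<omega>)) \<noteq> \<infinity>"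
    \<comment> \<open>The \<open>+ 1\<close> keeps \<open>D\<close> positive even for a path that
      vanishes identically, so that \<open>ln D\<close> is meaningful.\<close>
    define D where "D = enn2real (\<Sum>k. ennreal (Z k \<omega>)) + 1"
    have D1: "1 \<le> D" by (simp add: D_def)
    have ZD: "Z k \<omega> \<le> D" for k
    proof -
      have "ennreal (Z k \<omega>) \<le> (\<Sum>k. ennreal (Z k \<omega>))"
        using sum_le_suminf[of "\<lambda>k. ennreal (Z k \<omega>)" "{k}"] by simp
      then have "enn2real (ennreal (Z k \<omega>)) \<le> enn2real (\<Sum>k. ennreal (Z k \<omega>))"
        using fin by (intro enn2real_mono) (auto simp: less_top)
      then show ?thesis using nZ by (simp add: D_def)
    qed
    \<comment> \<open>At \<open>k = 0\<close> the quotient is 0 by the convention for division by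
      zero; the limsup ignores this term.\<close>
    have bound: "ereal (1 / (real k * \<Delta>)) * ext_ln (norm (X k \<omega>))
        \<le> ereal (ln D / (2 * \<Delta>) * (1 / real k) - \<kappa> / 2)" if "0 < k" for k
    proof (cases "X k \<omega> = 0")
      case True
      then show ?thesis using that \<Delta> by (simp add: ext_ln_def)
    next
      case False
      have "ln (Z k \<omega>) \<le> ln D"
        using ZD[of k] D1 False by (intro ln_mono) (auto simp: Z_def)
      also have "ln (Z k \<omega>) = \<kappa> * (real k * \<Delta>) + 2 * ln (norm (X k \<omega>))"
        using False by (simp add: Z_def ln_mult ln_realpow)
      finally have "ln (norm (X k \<omega>)) \<le> (ln D - \<kappa> * (real k * \<Delta>)) / 2" by simp
      then have "1 / (real k * \<Delta>) * ln (norm (X k \<omega>))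
          \<le> 1 / (real k * \<Delta>) * ((ln D - \<kappa> * (real k * \<Delta>)) / 2)"
        using \<Delta> by (intro mult_left_mono) auto
      also have "\<dots> = ln D / (2 * \<Delta>) * (1 / real k) - \<kappa> / 2"
        using that \<Delta> by (simp add: field_simps)
      finally show ?thesis using False by (simp add: ext_ln_def)
    qed
    have "limsup (\<lambda>k. ereal (1 / (real k * \<Delta>)) * ext_ln (norm (X k \<omega>)))
        \<le> limsup (\<lambda>k. ereal (ln D / (2 * \<Delta>) * (1 / real k) - \<kappa> / 2))"
      by (intro Limsup_mono) (use bound in \<open>auto simp: eventually_sequentially intro!: exI[of _ 1]\<close>)
    also have "\<dots> = ereal (ln D / (2 * \<Delta>) * 0 - \<kappa> / 2)"
      by (intro lim_imp_Limsup tendsto_ereal tendsto_intros lim_1_over_n) simp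
    finally show "limsup (\<lambda>k. ereal (1 / (real k * \<Delta>)) * ext_ln (norm (X k \<omega>))) \<le> ereal (- \<gamma> / 2 + \<epsilon>)"
      by (simp add: \<kappa>_def diff_divide_distrib)
  qed
qed

section \<open>Almost sure exponential stability for all sufficiently small step sizes\<close>

theorem theorem4p4:
  fixes M :: "'a measure" and \<F> :: "real \<Rightarrow> 'a measure"
    and B :: "real \<Rightarrow> 'a \<Rightarrow> real ^ 'm" and r :: "real \<Rightarrow> 'a \<Rightarrow> nat"
    and N i0 :: nat and \<Gamma> :: "nat \<Rightarrow> nat \<Rightarrow> real"
    and \<delta> :: "real \<Rightarrow> real" and \<tau> :: real and \<xi> :: "real \<Rightarrow> real ^ 'n"
    and F1 F :: "real ^ 'n \<Rightarrow> real ^ 'n \<Rightarrow> nat \<Rightarrow> real ^ 'n"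
    and G1 G :: "real ^ 'n \<Rightarrow> real ^ 'n \<Rightarrow> nat \<Rightarrow> real ^ 'm ^ 'n"
    and K1 \<rho> p K2 \<delta>b l1 l2 l3 l4 \<epsilon> \<Delta>s :: real and \<theta> :: ereal
    and \<mu> h :: "real \<Rightarrow> real"
  assumes prob: "prob_space M"
    and filtr: "usual_conditions M \<F>"
    and bm: "brownian_motion M \<F> B"
    and chain: "markov_chain M \<F> N \<Gamma> r"
    and chain_bm_indep: "independent_processes M r B"
    and init_state: "i0 \<in> {1..N}" "\<forall>\<omega>\<in>space M. r 0 \<omega> = i0"
    and delay: "0 < \<tau>" "\<forall>t\<ge>0. \<delta> t \<in> {0..\<tau>}" "\<delta> \<in> borel_measurable (restrict_space borel {0..})"
    and f_meas: "\<forall>i\<in>{1..N}. (\<lambda>(x, y). F1 x y i + F x y i) \<in> borel_measurable (borel \<Otimes>\<^sub>M borel)"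
    and g_meas: "\<forall>i\<in>{1..N}. (\<lambda>(x, y). G1 x y i + G x y i) \<in> borel_measurable (borel \<Otimes>\<^sub>M borel)"
    and A_const: "0 < K1" "0 \<le> \<rho>"
    and A_lip: "lipschitz_coeff N K1 F1" "lipschitz_coeff N K1 G1"
    and A_poly: "poly_lipschitz_coeff N K1 \<rho> F" "poly_lipschitz_coeff N K1 \<rho> G"
    and B_const: "2 \<le> p" "0 < K2"
    and B_cond: "khasminskii_condition N p K2 F G"
    and C_cond: "delay_condition \<delta> \<tau> \<delta>b"
    and S_const: "\<delta>b \<in> {0<..<1}"
    and S_cond: "stability_condition N \<theta> \<delta>b l1 l2 l3 l4 F1 G1 F G"
    and mu: "growth_function N F G \<mu>"
    and step: "\<Delta>s \<in> {0<..1}" "step_function \<Delta>s \<mu> h"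
    and eps: "0 < \<epsilon>" "\<epsilon> < 1 / 2 * (l1 - 2 * l3 - (1 - \<delta>b) * (l2 + l4))"
  shows "(\<exists>!\<gamma>. decay_root \<tau> \<delta>b l1 l2 l3 l4 \<epsilon> \<gamma>) \<and>
    (\<exists>\<Delta>b\<in>{0<..\<Delta>s}. \<forall>\<Delta>\<in>{0<..\<Delta>b}.
       AE \<omega> in M.
         limsup (\<lambda>k. ereal (1 / (real k * \<Delta>)) *
                     ext_ln (norm (ptem_scheme F1 G1 F G \<mu> h \<delta> \<xi> r B \<Delta> (int k) \<omega>)))
         \<le> ereal (- (THE \<gamma>. decay_root \<tau> \<delta>b l1 l2 l3 l4 \<epsilon> \<gamma>) / 2 + \<epsilon>))"
proof -
  interpret prob_space M by (rule prob)
  have db: "\<delta>b < 1" using S_const by simp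
  have "l2 \<ge> 0" "2 * (1 - \<delta>b) * l4 \<ge> 0"
    using S_cond unfolding stability_condition_def by blast+
  \<comment> \<open>As \<open>1 - \<delta>b\<close> is positive, the sign assumed for
    \<open>2 * (1 - \<delta>b) * l4\<close> is that of \<open>l4\<close>.\<close>
  then have b0: "0 \<le> (1 - \<delta>b) * (l2 + l4)"
    using db by (simp add: zero_le_mult_iff)
  note ex1 = ex1_decay_root[OF delay(1) b0 eps]
  define \<gamma> where "\<gamma> = (THE \<gamma>. decay_root \<tau> \<delta>b l1 l2 l3 l4 \<epsilon> \<gamma>)"
  have "decay_root \<tau> \<delta>b l1 l2 l3 l4 \<epsilon> \<gamma>"
    unfolding \<gamma>_def by (rule theI'[OF ex1])
  then have \<gamma>: "0 \<le> \<gamma>" "((1 - \<delta>b) * (l2 + l4) + \<epsilon>) * exp (\<gamma> * \<tau>) \<le> (l1 - 2 * l3 - \<epsilon>) - \<gamma>"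
    by (simp_all add: decay_root_def)
  obtain \<Delta>b where \<Delta>b: "\<Delta>b \<in> {0<..\<Delta>s}"
    and dr: "\<And>\<Delta>. \<Delta> \<in> {0<..\<Delta>b} \<Longrightarrow> \<Delta> * (l1 - 2 * l3 - \<epsilon>) \<le> 1 \<and> (\<exists>L\<ge>0. \<forall>i\<in>{1..N}. \<forall>x y.
       (norm (F1 x y i + truncated_coeff \<mu> h \<Delta> F x y i))\<^sup>2 \<le> L * ((norm x)\<^sup>2 + (norm y)\<^sup>2) \<and>
       (norm (G1 x y i + truncated_coeff \<mu> h \<Delta> G x y i))\<^sup>2 \<le> L * ((norm x)\<^sup>2 + (norm y)\<^sup>2) \<and>
       2 * (x \<bullet> (F1 x y i + truncated_coeff \<mu> h \<Delta> F x y i))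
         + (norm (G1 x y i + truncated_coeff \<mu> h \<Delta> G x y i))\<^sup>2
         + \<Delta> * (norm (F1 x y i + truncated_coeff \<mu> h \<Delta> F x y i))\<^sup>2
         \<le> - (l1 - 2 * l3 - \<epsilon>) * (norm x)\<^sup>2 + ((1 - \<delta>b) * (l2 + l4) + \<epsilon>) * (norm y)\<^sup>2)"
    using ptem_drift_le[OF A_const A_lip A_poly S_cond db mu step eps(1)] by blast
  have "AE \<omega> in M. limsup (\<lambda>k. ereal (1 / (real k * \<Delta>)) *
      ext_ln (norm (ptem_scheme F1 G1 F G \<mu> h \<delta> \<xi> r B \<Delta> (int k) \<omega>))) \<le> ereal (- \<gamma> / 2 + \<epsilon>)"
    if \<Delta>: "\<Delta> \<in> {0<..\<Delta>b}" for \<Delta>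
  proof -
    define f where "f = (\<lambda>x y i. F1 x y i + truncated_coeff \<mu> h \<Delta> F x y i)"
    define g where "g = (\<lambda>x y i. G1 x y i + truncated_coeff \<mu> h \<Delta> G x y i)"
    define X where "X = ptem_scheme F1 G1 F G \<mu> h \<delta> \<xi> r B \<Delta>"
    \<comment> \<open>The lag of the step from \<open>k\<close> to \<open>k + 1\<close>;
      \<open>em_scheme\<close> is indexed by the new state, hence its \<open>k - 1\<close>.\<close>
    define d where "d = (\<lambda>k. int (nat \<lfloor>\<delta> (real k * \<Delta>) / \<Delta>\<rfloor>))"
    have \<Delta>0: "0 < \<Delta>" using \<Delta> by simp
    have X_eq: "X k \<omega> = em_scheme f g \<delta> \<xi> \<Delta> (\<lambda>t. r t \<omega>) (\<lambda>t. B t \<omega>) k" for k \<omega>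
      by (simp add: X_def ptem_scheme_def f_def g_def)
    from dr[OF \<Delta>] obtain L where \<Delta>a: "\<Delta> * (l1 - 2 * l3 - \<epsilon>) \<le> 1"
      and L: "\<And>i x y. i \<in> {1..N} \<Longrightarrow> (norm (f x y i))\<^sup>2 \<le> L * ((norm x)\<^sup>2 + (norm y)\<^sup>2)"
      "\<And>i x y. i \<in> {1..N} \<Longrightarrow> (norm (g x y i))\<^sup>2 \<le> L * ((norm x)\<^sup>2 + (norm y)\<^sup>2)"
      "\<And>i x y. i \<in> {1..N} \<Longrightarrow> 2 * (x \<bullet> f x y i) + (norm (g x y i))\<^sup>2 + \<Delta> * (norm (f x y i))\<^sup>2
         \<le> - (l1 - 2 * l3 - \<epsilon>) * (norm x)\<^sup>2 + ((1 - \<delta>b) * (l2 + l4) + \<epsilon>) * (norm y)\<^sup>2"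
      unfolding f_def g_def by blast
    have K1: "0 \<le> K1" using A_const by simp
    note A_lip' = lipschitz_imp_poly_lipschitz[OF K1 A_lip(1)] lipschitz_imp_poly_lipschitz[OF K1 A_lip(2)]
    have fm: "(\<lambda>(x, y). f x y i) \<in> borel_measurable (borel \<Otimes>\<^sub>M borel)" if "i \<in> {1..N}" for i
      using poly_lipschitz_measurable[OF A_lip'(1) order_refl that]
        truncated_coeff_measurable[where \<phi> = F, OF poly_lipschitz_measurable[OF A_poly(1) A_const(2) that], of \<mu> h \<Delta>]
      unfolding f_def case_prod_beta by (rule borel_measurable_add)
    have gm: "(\<lambda>(x, y). g x y i) \<in> borel_measurable (borel \<Otimes>\<^sub>M borel)" if "i \<in> {1..N}" for i
      using poly_lipschitz_measurable[OF A_lip'(2) order_refl that]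
        truncated_coeff_measurable[where \<phi> = G, OF poly_lipschitz_measurable[OF A_poly(2) A_const(2) that], of \<mu> h \<Delta>]
      unfolding g_def case_prod_beta by (rule borel_measurable_add)
    have "\<exists>C\<ge>0. \<forall>k::nat. integrable M (\<lambda>\<omega>. (norm (X (int k) \<omega>))\<^sup>2) \<and>
        expectation (\<lambda>\<omega>. (norm (X (int k) \<omega>))\<^sup>2) \<le> C * exp (- \<gamma> * (real k * \<Delta>))"
    proof (rule em_second_moment_decay[where f = f and g = g and r = r and d = d and B = B and \<F> = \<F>
          and N = N and L = L and c = "\<lambda>k. \<xi> (of_int k * \<Delta>)", OF _ _ bm _ _ fm gm L \<Delta>0 \<Delta>a _ \<gamma>])
      show "subalgebra M (\<F> t)" if "0 \<le> t" for t
        using filtr that unfolding usual_conditions_def by blast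
      show "sets (\<F> s) \<subseteq> sets (\<F> t)" if "0 \<le> s" "s \<le> t" for s t
        using filtr that unfolding usual_conditions_def by blast
      show "r t \<in> measurable (\<F> t) (count_space UNIV)" if "0 \<le> t" for t
        using chain that unfolding markov_chain_def by blast
      show "r t \<omega> \<in> {1..N}" if "0 \<le> t" "\<omega> \<in> space M" for t \<omega>
        using chain that unfolding markov_chain_def by blast
      show "0 \<le> (1 - \<delta>b) * (l2 + l4) + \<epsilon>" using b0 eps by simp
      show "X k \<omega> = \<xi> (of_int k * \<Delta>)" if "k \<le> 0" for k \<omega>
        using that by (simp add: X_eq em_scheme.simps)
      show "0 \<le> d k" for k by (simp add: d_def)
      \<comment> \<open>Rounding down can only shorten the nonnegative delay, so the bound
        \<open>\<tau>\<close> survives discretisation.\<close>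
      show "of_int (d k) * \<Delta> \<le> \<tau>" for k
      proof -
        have dl: "0 \<le> \<delta> (real k * \<Delta>)" "\<delta> (real k * \<Delta>) \<le> \<tau>" using delay(2) \<Delta>0 by auto
        then have "of_int (d k) \<le> \<delta> (real k * \<Delta>) / \<Delta>"
          using \<Delta>0 by (simp add: d_def)
        then show ?thesis using \<Delta>0 dl by (simp add: pos_le_divide_eq)
      qed
      show "X (int k + 1) \<omega> = X (int k) \<omega>
          + \<Delta> *\<^sub>R f (X (int k) \<omega>) (X (int k - d k) \<omega>) (r (real k * \<Delta>) \<omega>)
          + g (X (int k) \<omega>) (X (int k - d k) \<omega>) (r (real k * \<Delta>) \<omega>)
              *v (B (real (Suc k) * \<Delta>) \<omega> - B (real k * \<Delta>) \<omega>)" for k \<omega>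
        unfolding X_eq by (subst em_scheme.simps) (simp add: d_def Let_def add.commute)
    qed
    then obtain C where "\<And>k. integrable M (\<lambda>\<omega>. (norm (X (int k) \<omega>))\<^sup>2)"
      "\<And>k. expectation (\<lambda>\<omega>. (norm (X (int k) \<omega>))\<^sup>2) \<le> C * exp (- \<gamma> * (real k * \<Delta>))" by blast
    from limsup_ln_le_if_exp_moment[where X = "\<lambda>k. X (int k)", OF this \<Delta>0 eps(1)]
    show ?thesis by (simp add: X_def)
  qed
  then show ?thesis
    unfolding \<gamma>_def[symmetric] using ex1 \<Delta>b by blast
qed

end
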